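(* Let $D=(0,1)$, $\alpha\in(3/2,2)$, $V=H^1_0(D)$, $q\in L^\infty(D)$, $p\in L^2(D)$, $f\in L^2(D)$, and let $A(\psi,\varphi)=(\psi',\varphi')+({}_0^RD_x^{2-\alpha}\psi,q\varphi)+({}_0^RD_x^{2-\alpha}\psi)(1)(p,\varphi)$ satisfy: $A(w,v)=0\ \forall v\in V\Rightarrow w=0$, and $A(w,v)=0\ \forall w\in V\Rightarrow v=0$. Let $V_h\subset V$ be the finite element space defined below. Then there is $h_0>0$ such that for all $h\le h_0$ the problem of finding $w_h\in V_h$ with $A(w_h,v_h)=(f,v_h)$ for all $v_h\in V_h$ has a unique solution, and $\|w_h\|_{H^1(D)}\le c\|f\|_{L^2(D)}$ with $c$ independent of $h$ and $f$.
   Context: $(\cdot,\cdot)$ is the $L^2(D)$ inner product. For $w\in H^1_0(D)$, ${}_0^RD_x^{2-\alpha}w(x)=\frac{1}{\Gamma(\alpha-1)}\int_0^x(x-t)^{\alpha-2}w'(t)dt$ and $({}_0^RD_x^{2-\alpha}w)(1)=\frac{1}{\Gamma(\alpha-1)}\int_0^1(1-t)^{\alpha-2}w'(t)dt$. $V_h$: given a quasi-uniform partition of $D$ with maximal subinterval length $h$ and a fixed $k\in\{0,1\}$, $V_h$ is the space of continuous piecewise polynomials of degree at most $k+1$ on the partition vanishing at $x=0$ and $x=1$. *)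

theory Defs
  imports "HOL-Analysis.Analysis" "HOL-Computational_Algebra.Polynomial"
begin

text \<open>Functions on D = (0,1) are represented as real \<Rightarrow> real; integrals over D are
Lebesgue integrals over [0,1] (the endpoints are a null set).\<close>

definition L2 :: "(real \<Rightarrow> real) \<Rightarrow> bool" where
  "L2 f \<longleftrightarrow> f \<in> borel_measurable (lebesgue_on {0..1})
           \<and> integrable (lebesgue_on {0..1}) (\<lambda>x. (f x)\<^sup>2)"

definition Linf :: "(real \<Rightarrow> real) \<Rightarrow> bool" where
  "Linf f \<longleftrightarrow> f \<in> borel_measurable (lebesgue_on {0..1})
           \<and> (\<exists>C. AE x in lebesgue_on {0..1}. \<bar>f x\<bar> \<le> C)"

definition ip :: "(real \<Rightarrow> real) \<Rightarrow> (real \<Rightarrow> real) \<Rightarrow> real" where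
  "ip u v = integral\<^sup>L (lebesgue_on {0..1}) (\<lambda>x. u x * v x)"

definition L2norm :: "(real \<Rightarrow> real) \<Rightarrow> real" where
  "L2norm u = sqrt (ip u u)"

text \<open>H^1_0(D): absolutely continuous functions w(x) = int_0^x g with g in L2,
  w(1) = 0; outside [0,1] the representative is taken to be 0 (normalisation).\<close>
definition H10 :: "(real \<Rightarrow> real) set" where
  "H10 = {w. (\<exists>g. L2 g \<and> (\<forall>x\<in>{0..1}. w x = integral\<^sup>L (lebesgue_on {0..x}) g))
             \<and> w 1 = 0 \<and> (\<forall>x. x \<notin> {0..1} \<longrightarrow> w x = 0)}"

text \<open>Weak derivative (determined a.e. on [0,1]).\<close>
definition wderiv :: "(real \<Rightarrow> real) \<Rightarrow> (real \<Rightarrow> real)" where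
  "wderiv w = (SOME g. L2 g \<and> (\<forall>x\<in>{0..1}. w x = integral\<^sup>L (lebesgue_on {0..x}) g))"

definition H1norm :: "(real \<Rightarrow> real) \<Rightarrow> real" where
  "H1norm w = sqrt (ip w w + ip (wderiv w) (wderiv w))"

text \<open>Riemann-Liouville derivative of order 2 - alpha:
  (1/Gamma(alpha-1)) int_0^x (x-t)^(alpha-2) w'(t) dt.\<close>
definition RLD :: "real \<Rightarrow> (real \<Rightarrow> real) \<Rightarrow> real \<Rightarrow> real" where
  "RLD \<alpha> w x = (1 / Gamma (\<alpha> - 1)) *
      integral\<^sup>L (lebesgue_on {0..x}) (\<lambda>t. (x - t) powr (\<alpha> - 2) * wderiv w t)"

definition Aform :: "real \<Rightarrow> (real \<Rightarrow> real) \<Rightarrow> (real \<Rightarrow> real)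
     \<Rightarrow> (real \<Rightarrow> real) \<Rightarrow> (real \<Rightarrow> real) \<Rightarrow> real" where
  "Aform \<alpha> q p \<psi> \<phi> = ip (wderiv \<psi>) (wderiv \<phi>)
      + ip (RLD \<alpha> \<psi>) (\<lambda>x. q x * \<phi> x) + RLD \<alpha> \<psi> 1 * ip p \<phi>"

definition partition :: "nat \<Rightarrow> (nat \<Rightarrow> real) \<Rightarrow> bool" where
  "partition N xs \<longleftrightarrow> N \<ge> 1 \<and> xs 0 = 0 \<and> xs N = 1 \<and> (\<forall>i<N. xs i < xs (Suc i))"

definition mesh :: "nat \<Rightarrow> (nat \<Rightarrow> real) \<Rightarrow> real" where
  "mesh N xs = Max ((\<lambda>i. xs (Suc i) - xs i) ` {..<N})"

definition quasi_uniform :: "real \<Rightarrow> nat \<Rightarrow> (nat \<Rightarrow> real) \<Rightarrow> bool" where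
  "quasi_uniform \<sigma> N xs \<longleftrightarrow> (\<forall>i<N. xs (Suc i) - xs i \<ge> \<sigma> * mesh N xs)"

definition Vh :: "nat \<Rightarrow> nat \<Rightarrow> (nat \<Rightarrow> real) \<Rightarrow> (real \<Rightarrow> real) set" where
  "Vh k N xs = {v. continuous_on {0..1} v \<and> v 0 = 0 \<and> v 1 = 0
      \<and> (\<forall>x. x \<notin> {0..1} \<longrightarrow> v x = 0)
      \<and> (\<forall>i<N. \<exists>P :: real poly. degree P \<le> k + 1
              \<and> (\<forall>x\<in>{xs i..xs (Suc i)}. v x = poly P x))}"

end

(* A(w,v) = (w',v') + (g,v) with g = q RLD w + (RLD w)(1) p, and |g| <= K |w'| in L2 because the
   kernel (x-t)^(alpha-2) is square integrable for alpha > 3/2. By Fubini (g,v) = -(G,v') with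
   G(x) = int_0^x g, which is Hoelder-1/2 continuous. If w in V_h satisfies |A(w,v)| <= eps |v'| for all
   v in V_h, then comparing w' with a step approximation of G (a constant away from V_h') gives
   |w' - (G - m)| <= eps + 2 sqrt(h) |g| for some constant m.

   A failure of the discrete inf-sup condition yields such w_n with |w_n'| = 1 and eps, h -> 0. The
   functions G_n - m_n are bounded and equicontinuous, so by Arzela-Ascoli a subsequence, and with it
   w_n', converges in L2. The limit w satisfies w' = G - m, i.e. A(w,v) = 0 for all v, whence w = 0,
   contradicting |w'| = 1. So the discrete problem is injective and stable for small h, and it is
   solvable because V_h is finite-dimensional. *)

theory Submission
  imports Defs "HOL-Complex_Analysis.Great_Picard" "HOL-Library.Function_Algebras"
begin

subsection \<open>The space of square integrable functions\<close>

text \<open>The form is a compact perturbation of (w',v'), and the Fredholm alternative is carried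
  out by hand. The functions w_n of the contradiction argument live on unrelated partitions, so no
  single discrete space holds them; compactness has to come from the primitives G_n, whose Hoelder
  bound depends on |g_n| alone and not on the partition. The constants m arise because functions
  vanishing at both ends have derivatives of mean zero, so that testing sees w' - G only modulo
  constants. The price of compactness is that neither h0 nor the stability constant is explicit. A
  technical obstacle runs through the file: \<open>wderiv\<close> is a choice, so derivatives add
  and scale only almost everywhere, while the elements of \<open>H10\<close> and \<open>Vh\<close>
  are genuine functions. Primitives mediate between the two.\<close>

abbreviation unit_measure :: "real measure" where
  "unit_measure \<equiv> lebesgue_on {0..1}"

lemma finite_measure_unit: "finite_measure unit_measure"
  by (intro finite_measureI) (simp add: emeasure_restrict_space)

lemma L2_measurable: "L2 f \<Longrightarrow> f \<in> borel_measurable unit_measure"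
  by (simp add: L2_def)

lemma integrable_mult_L2:
  assumes "L2 f" "L2 g"
  shows "integrable unit_measure (\<lambda>x. f x * g x)"
proof (rule Bochner_Integration.integrable_bound)
  show "integrable unit_measure (\<lambda>x. (f x)\<^sup>2 + (g x)\<^sup>2)"
    using assms by (simp add: L2_def)
  show "(\<lambda>x. f x * g x) \<in> borel_measurable unit_measure"
    using assms by (auto simp: L2_def)
  have "\<bar>a * b\<bar> \<le> a\<^sup>2 + b\<^sup>2" for a b :: real
    using sum_squares_bound[of a b] sum_squares_bound[of a "-b"] zero_le_power2[of a] zero_le_power2[of b]
    by (simp add: abs_le_iff)
  then show "AE x in unit_measure. norm (f x * g x) \<le> norm ((f x)\<^sup>2 + (g x)\<^sup>2)"
    by simp
qed

lemma L2_add: "L2 f \<Longrightarrow> L2 g \<Longrightarrow> L2 (\<lambda>x. f x + g x)"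
  using integrable_mult_L2[of f g] by (auto simp: L2_def power2_sum mult.assoc)

lemma L2_cmult: "L2 f \<Longrightarrow> L2 (\<lambda>x. c * f x)"
  by (auto simp: L2_def power_mult_distrib)

lemma L2_diff: "L2 f \<Longrightarrow> L2 g \<Longrightarrow> L2 (\<lambda>x. f x - g x)"
  using L2_add[of f "\<lambda>x. (-1) * g x"] L2_cmult[of g "-1"] by simp

lemma L2_AE_bounded:
  assumes [measurable]: "f \<in> borel_measurable unit_measure" and "AE x in unit_measure. \<bar>f x\<bar> \<le> C"
  shows "L2 f"
  unfolding L2_def
proof
  interpret finite_measure unit_measure by (rule finite_measure_unit)
  show "integrable unit_measure (\<lambda>x. (f x)\<^sup>2)"
  proof (rule integrable_const_bound)
    show "AE x in unit_measure. norm ((f x)\<^sup>2) \<le> C\<^sup>2"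
      using assms(2) by eventually_elim (metis abs_ge_zero norm_power power2_abs power_mono real_norm_def)
  qed measurable
qed fact

lemma L2_bounded:
  assumes "f \<in> borel_measurable unit_measure" "\<And>x. x \<in> {0..1} \<Longrightarrow> \<bar>f x\<bar> \<le> C"
  shows "L2 f"
  using assms by (intro L2_AE_bounded[where C = C]) (auto intro!: AE_I2)

lemma L2_const: "L2 (\<lambda>x. c)"
  by (rule L2_bounded[where C = "\<bar>c\<bar>"]) auto

lemma L2_indicator: "A \<in> sets borel \<Longrightarrow> L2 (indicator A)"
  by (rule L2_bounded[where C = 1])
    (auto simp: indicator_def intro!: borel_measurable_indicator sets_restrict_space_iff[THEN iffD2] measurable_restrict_space1)

lemma L2_continuous:
  assumes "continuous_on {0..1} f"
  shows "L2 f"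
proof -
  have "compact (f ` {0..1})"
    by (rule compact_continuous_image[OF assms]) simp
  then obtain C where "\<And>x. x \<in> {0..1} \<Longrightarrow> \<bar>f x\<bar> \<le> C"
    using compact_imp_bounded bounded_iff by (metis imageI real_norm_def)
  then show ?thesis
    using assms by (intro L2_bounded) (auto intro: continuous_imp_measurable_on_sets_lebesgue)
qed

lemma L2_Linf_mult:
  assumes "Linf q" "L2 f"
  shows "L2 (\<lambda>x. q x * f x)"
  unfolding L2_def
proof
  obtain C where C: "AE x in unit_measure. \<bar>q x\<bar> \<le> C"
    using assms by (auto simp: Linf_def)
  have m [measurable]: "q \<in> borel_measurable unit_measure" "f \<in> borel_measurable unit_measure"
    using assms by (auto simp: Linf_def L2_def)
  show "(\<lambda>x. q x * f x) \<in> borel_measurable unit_measure"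
    by measurable
  show "integrable unit_measure (\<lambda>x. (q x * f x)\<^sup>2)"
  proof (rule Bochner_Integration.integrable_bound)
    show "integrable unit_measure (\<lambda>x. C\<^sup>2 * (f x)\<^sup>2)"
      using assms by (simp add: L2_def)
    show "AE x in unit_measure. norm ((q x * f x)\<^sup>2) \<le> norm (C\<^sup>2 * (f x)\<^sup>2)"
      using C
    proof eventually_elim
      case (elim x)
      then have "(q x)\<^sup>2 \<le> C\<^sup>2"
        by (metis abs_ge_zero power2_abs power_mono)
      then show ?case
        by (simp add: power_mult_distrib mult_right_mono)
    qed
  qed measurable
qed

lemma L2_integrable: "L2 f \<Longrightarrow> integrable unit_measure f"
  using integrable_mult_L2[OF L2_const[of 1], of f] by simp

section \<open>The inner product and its norm\<close>

lemma ip_commute: "ip f g = ip g f"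
  by (simp add: ip_def mult.commute)

lemma ip_cong_AE:
  assumes "AE x in unit_measure. f x = f' x" "AE x in unit_measure. g x = g' x"
    and "L2 f" "L2 f'" "L2 g" "L2 g'"
  shows "ip f g = ip f' g'"
  unfolding ip_def
proof (rule integral_cong_AE)
  show "AE x in unit_measure. f x * g x = f' x * g' x"
    using assms(1,2) by eventually_elim simp
qed (use assms(3-) in \<open>auto intro: borel_measurable_times L2_measurable\<close>)

lemma ip_add_left: "L2 f \<Longrightarrow> L2 g \<Longrightarrow> L2 h \<Longrightarrow> ip (\<lambda>x. f x + g x) h = ip f h + ip g h"
  by (simp add: ip_def distrib_right integrable_mult_L2)

lemma ip_diff_left: "L2 f \<Longrightarrow> L2 g \<Longrightarrow> L2 h \<Longrightarrow> ip (\<lambda>x. f x - g x) h = ip f h - ip g h"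
  by (simp add: ip_def left_diff_distrib integrable_mult_L2)

lemma ip_cmult_left: "ip (\<lambda>x. c * f x) h = c * ip f h"
  by (simp add: ip_def mult.assoc)

lemma ip_add_right: "L2 f \<Longrightarrow> L2 g \<Longrightarrow> L2 h \<Longrightarrow> ip h (\<lambda>x. f x + g x) = ip h f + ip h g"
  by (simp add: ip_commute[of h] ip_add_left)

lemma ip_diff_right: "L2 f \<Longrightarrow> L2 g \<Longrightarrow> L2 h \<Longrightarrow> ip h (\<lambda>x. f x - g x) = ip h f - ip h g"
  by (simp add: ip_commute[of h] ip_diff_left)

lemma ip_cmult_right: "ip h (\<lambda>x. c * f x) = c * ip h f"
  by (simp add: ip_commute[of h] ip_cmult_left)

lemma ip_self_nonneg: "0 \<le> ip f f"
  by (simp add: ip_def)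

lemma L2norm_nonneg: "0 \<le> L2norm f"
  by (simp add: L2norm_def ip_self_nonneg)

lemma L2norm_sq: "(L2norm f)\<^sup>2 = ip f f"
  by (simp add: L2norm_def ip_self_nonneg)

lemma L2norm_cmult: "L2norm (\<lambda>x. c * f x) = \<bar>c\<bar> * L2norm f"
proof -
  have "ip (\<lambda>x. c * f x) (\<lambda>x. c * f x) = c\<^sup>2 * ip f f"
    by (simp add: ip_cmult_left ip_cmult_right power2_eq_square)
  then show ?thesis
    by (simp add: L2norm_def real_sqrt_mult)
qed

lemma L2norm_minus_commute: "L2norm (\<lambda>x. f x - g x) = L2norm (\<lambda>x. g x - f x)"
  using L2norm_cmult[of "-1" "\<lambda>x. f x - g x"] by simp

text \<open>The polynomial t -> |f - t g|^2 is nonnegative, and its value at the minimiser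
  (f,g)/(g,g) gives the claim. Since \<open>ip\<close> is only semidefinite on functions, (g,g) = 0
  is a case of its own, in which the polynomial is affine in t.\<close>

lemma ip_Cauchy_Schwarz:
  assumes "L2 f" "L2 g"
  shows "\<bar>ip f g\<bar> \<le> L2norm f * L2norm g"
proof -
  have pos: "0 \<le> ip f f - 2 * t * ip f g + t\<^sup>2 * ip g g" for t
  proof -
    have "0 \<le> ip (\<lambda>x. f x - t * g x) (\<lambda>x. f x - t * g x)"
      by (rule ip_self_nonneg)
    also have "\<dots> = ip f f - 2 * t * ip f g + t\<^sup>2 * ip g g"
      using assms by (simp add: ip_diff_left ip_diff_right L2_diff L2_cmult ip_cmult_left ip_cmult_right
          ip_commute[of g f] power2_eq_square algebra_simps)
    finally show ?thesis .
  qed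
  have "(ip f g)\<^sup>2 \<le> ip f f * ip g g"
  proof (cases "ip g g = 0")
    case True
    have "ip f g = 0"
    proof (rule ccontr)
      assume "ip f g \<noteq> 0"
      \<comment> \<open>At this t the affine function takes the value -1.\<close>
      then show False
        using pos[of "(ip f f + 1) / (2 * ip f g)"] True by (simp add: field_simps)
    qed
    then show ?thesis
      by (simp add: ip_self_nonneg)
  next
    case False
    then have "0 < ip g g"
      using ip_self_nonneg[of g] by simp
    then show ?thesis
      using pos[of "ip f g / ip g g"] by (simp add: field_simps power2_eq_square)
  qed
  then have "(ip f g)\<^sup>2 \<le> (L2norm f * L2norm g)\<^sup>2"
    by (simp add: power_mult_distrib L2norm_sq)
  then show ?thesis
    by (metis L2norm_nonneg mult_nonneg_nonneg abs_le_square_iff abs_of_nonneg)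
qed

lemma L2norm_triangle:
  assumes "L2 f" "L2 g"
  shows "L2norm (\<lambda>x. f x + g x) \<le> L2norm f + L2norm g"
proof -
  have "(L2norm (\<lambda>x. f x + g x))\<^sup>2 = (L2norm f)\<^sup>2 + 2 * ip f g + (L2norm g)\<^sup>2"
    using assms by (simp add: L2norm_sq ip_add_left ip_add_right L2_add ip_commute[of g f])
  also have "\<dots> \<le> (L2norm f + L2norm g)\<^sup>2"
    using ip_Cauchy_Schwarz[OF assms] by (simp add: power2_sum)
  finally show ?thesis
    by (meson L2norm_nonneg add_nonneg_nonneg power2_le_imp_le)
qed

lemma L2norm_diff_triangle:
  assumes "L2 f" "L2 g" "L2 h"
  shows "L2norm (\<lambda>x. f x - h x) \<le> L2norm (\<lambda>x. f x - g x) + L2norm (\<lambda>x. g x - h x)"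
  using L2norm_triangle[OF L2_diff[OF assms(1,2)] L2_diff[OF assms(2,3)]] by simp

lemma L2norm_AE_bound:
  assumes "f \<in> borel_measurable unit_measure" "AE x in unit_measure. \<bar>f x\<bar> \<le> C * \<bar>g x\<bar>" "L2 g" "0 \<le> C"
  shows "L2norm f \<le> C * L2norm g"
proof -
  have "ip f f \<le> C\<^sup>2 * ip g g"
    unfolding ip_def power2_eq_square[symmetric] integral_mult_right_zero[symmetric]
  proof (rule integral_mono_AE')
    show "integrable unit_measure (\<lambda>x. C\<^sup>2 * (g x)\<^sup>2)"
      using assms by (simp add: L2_def)
    show "AE x in unit_measure. (f x)\<^sup>2 \<le> C\<^sup>2 * (g x)\<^sup>2"
      using assms(2) by eventually_elim (metis abs_ge_zero power2_abs power_mono power_mult_distrib)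
  qed simp
  then have "L2norm f \<le> sqrt (C\<^sup>2 * ip g g)"
    by (simp add: L2norm_def)
  then show ?thesis
    using assms(4) by (simp add: L2norm_def real_sqrt_mult)
qed

lemma L2norm_one: "L2norm (\<lambda>x. 1) = 1"
  by (simp add: L2norm_def ip_def measure_restrict_space)

lemma L2norm_bound:
  assumes "f \<in> borel_measurable unit_measure" "\<And>x. x \<in> {0..1} \<Longrightarrow> \<bar>f x\<bar> \<le> C" "0 \<le> C"
  shows "L2norm f \<le> C"
proof -
  have "AE x in unit_measure. \<bar>f x\<bar> \<le> C * \<bar>1\<bar>"
    by (rule AE_I2) (use assms(2) in simp)
  then show ?thesis
    using L2norm_AE_bound[of f C "\<lambda>x. 1"] assms by (simp add: L2_const L2norm_one)
qed


subsection \<open>Weak derivatives\<close>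

lemma ip_cong:
  assumes "\<And>x. x \<in> {0..1} \<Longrightarrow> f x = f' x" "\<And>x. x \<in> {0..1} \<Longrightarrow> g x = g' x"
  shows "ip f g = ip f' g'"
  unfolding ip_def by (rule Bochner_Integration.integral_cong) (use assms in auto)

text \<open>Writing primitives as inner products with an indicator makes linearity and
  Cauchy-Schwarz for \<open>ip\<close> available for them.\<close>

lemma integral_initial_eq_ip:
  assumes "x \<in> {0..1}"
  shows "integral\<^sup>L (lebesgue_on {0..x}) g = ip (indicator {0..x}) g"
proof -
  have "integral\<^sup>L (lebesgue_on {0..x}) g = (\<integral>t. indicator {0..x} t *\<^sub>R g t \<partial>lebesgue)"
    by (rule integral_restrict_space) simp
  also have "\<dots> = (\<integral>t. indicator {0..1} t *\<^sub>R (indicator {0..x} t * g t) \<partial>lebesgue)"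
    by (rule Bochner_Integration.integral_cong) (use assms in \<open>auto simp: indicator_def\<close>)
  also have "\<dots> = ip (indicator {0..x}) g"
    unfolding ip_def by (rule integral_restrict_space[symmetric]) simp
  finally show ?thesis .
qed

lemma L2_indicator_Icc: "L2 (indicator {0..x})"
  by (rule L2_indicator) simp

lemma primitive_continuous:
  assumes "L2 g"
  shows "continuous_on {0..1} (\<lambda>x. ip (indicator {0..x}) g)"
proof -
  have "continuous_on {0..1} (\<lambda>x. integral\<^sup>L (lebesgue_on {0..x}) g)"
    by (rule indefinite_integral_continuous_real[OF L2_integrable[OF assms]])
  then show ?thesis
    by (rule continuous_on_eq) (rule integral_initial_eq_ip)
qed

lemma ip_indicator_diff:
  assumes "L2 g" "0 \<le> x" "x \<le> y" "y \<le> 1"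
  shows "ip (indicator {0..y}) g - ip (indicator {0..x}) g = ip (indicator {x<..y}) g"
proof -
  have "ip (\<lambda>t. indicator {0..y} t - indicator {0..x} t) g = ip (indicator {0..y}) g - ip (indicator {0..x}) g"
    by (rule ip_diff_left) (simp_all add: L2_indicator assms)
  moreover have "(\<lambda>t. indicator {0..y} t - indicator {0..x} t) = (indicator {x<..y} :: real \<Rightarrow> real)"
    using assms by (auto simp: indicator_def fun_eq_iff)
  ultimately show ?thesis
    by simp
qed

lemma L2norm_indicator_interval:
  assumes "0 \<le> x" "x \<le> y" "y \<le> 1"
  shows "L2norm (indicator {x<..y}) = sqrt (y - x)"
proof -
  have "ip (indicator {x<..y}) (indicator {x<..y}) = (\<integral>t. indicator {x<..y} t \<partial>unit_measure)"
    unfolding ip_def by (rule Bochner_Integration.integral_cong) (auto simp: indicator_def)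
  also have "\<dots> = measure unit_measure ({x<..y} \<inter> space unit_measure)"
    by (rule Bochner_Integration.integral_indicator)
  also have "{x<..y} \<inter> space unit_measure = {x<..y}"
    using assms by auto
  also have "measure unit_measure {x<..y} = y - x"
    using assms by (subst measure_restrict_space) auto
  finally show ?thesis
    by (simp add: L2norm_def)
qed

text \<open>Cauchy-Schwarz against the indicator of the interval between the two points, whose norm
  is the square root of its length.\<close>

lemma primitive_Hoelder:
  assumes "L2 g" "x \<in> {0..1}" "y \<in> {0..1}"
  shows "\<bar>ip (indicator {0..x}) g - ip (indicator {0..y}) g\<bar> \<le> sqrt \<bar>x - y\<bar> * L2norm g"
proof -
  have *: "\<bar>ip (indicator {0..b}) g - ip (indicator {0..a}) g\<bar> \<le> sqrt \<bar>b - a\<bar> * L2norm g"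
    if "0 \<le> a" "a \<le> b" "b \<le> 1" for a b
    using ip_Cauchy_Schwarz[OF L2_indicator[of "{a<..b}"] assms(1)] that
    by (simp add: ip_indicator_diff[OF assms(1)] L2norm_indicator_interval)
  show ?thesis
    using *[of x y] *[of y x] assms(2,3) by (cases "x \<le> y") (auto simp: abs_minus_commute)
qed

lemma ip_indicator_singleton: "ip (indicator {0}) g = 0"
proof -
  have "AE x in lebesgue. x \<in> {0..1} \<longrightarrow> indicat_real {0} x * g x = 0"
    by (rule AE_I'[of "{0}"]) (auto simp: indicator_def)
  then have "AE x in unit_measure. indicat_real {0} x * g x = 0"
    by (subst AE_restrict_space_iff) auto
  then show ?thesis
    unfolding ip_def by (rule integral_eq_zero_AE)
qed

lemma ip_indicator_Icc_1: "ip (indicator {0..1}) g = ip (\<lambda>_. 1) g"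
  unfolding ip_def by (rule Bochner_Integration.integral_cong) auto

text \<open>Uniqueness of weak derivatives by Lebesgue differentiation: off a null set, g is the
  limit of its averages over [x, x+h], and these averages are all 0.\<close>

lemma AE_0_of_primitive_0:
  assumes "L2 g" and zero: "\<And>x. x \<in> {0..1} \<Longrightarrow> ip (indicator {0..x}) g = 0"
  shows "AE x in unit_measure. g x = 0"
proof -
  have prim: "(g has_integral 0) {0..x}" if "x \<in> {0..1}" for x
  proof -
    have "integrable (lebesgue_on {0..x}) g"
      using that by (intro integrable_subinterval[OF L2_integrable[OF assms(1)]]) auto
    from has_integral_integral_lebesgue_on[OF this] show ?thesis
      using that by (simp add: integral_initial_eq_ip zero)
  qed
  \<comment> \<open>Extension by zero, because the differentiation theorem asks for integrability on
    every bounded interval.\<close>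
  define f where "f = (\<lambda>x. if x \<in> {0..1} then g x else 0)"
  have "f integrable_on UNIV"
    unfolding f_def by (subst integrable_restrict_UNIV) (use prim[of 1] in auto)
  then have "f integrable_on cbox a b" for a b
    using integrable_on_subcbox by blast
  then obtain N where N: "negligible N"
    "\<And>x e. x \<notin> N \<Longrightarrow> 0 < e \<Longrightarrow>
      \<exists>d>0. \<forall>h. 0 < h \<and> h < d \<longrightarrow> norm (integral (cbox x (x + h *\<^sub>R One)) f /\<^sub>R h ^ DIM(real) - f x) < e"
    by (rule integrable_ccontinuous_explicit) blast
  have "g x = 0" if x: "x \<in> {0..<1}" "x \<notin> N" for x
  proof (rule ccontr)
    assume "g x \<noteq> 0"
    then obtain d where d: "d > 0"
      "\<And>h. 0 < h \<Longrightarrow> h < d \<Longrightarrow> norm (integral {x..x + h} f / h - g x) < \<bar>g x\<bar>"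
      using N(2)[OF x(2), of "\<bar>g x\<bar>"] x by (auto simp: f_def divide_inverse mult.commute)
    obtain h where h: "0 < h" "h < d" "x + h \<le> 1"
      using d(1) x(1) by (intro that[of "min (d/2) (1 - x)"]) (auto simp: min_def)
    have "integral {0..x} g + integral {x..x + h} g = integral {0..x + h} g"
      using h x prim[of "x + h"] by (intro Henstock_Kurzweil_Integration.integral_combine) auto
    then have "integral {x..x + h} g = 0"
      using prim[of x] prim[of "x + h"] x h by (auto dest!: integral_unique)
    moreover have "integral {x..x + h} f = integral {x..x + h} g"
      by (rule Henstock_Kurzweil_Integration.integral_cong) (use x h in \<open>auto simp: f_def\<close>)
    ultimately show False
      using d(2)[OF h(1,2)] by simp
  qed
  \<comment> \<open>The averages are taken to the right of x, so the endpoint 1 joins the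
    exceptional set.\<close>
  moreover have "N \<union> {1} \<in> null_sets lebesgue"
    using N(1) by (simp add: negligible_iff_null_sets[symmetric])
  ultimately have "AE x in lebesgue. x \<in> {0..1} \<longrightarrow> g x = 0"
    by (intro AE_I'[of "N \<union> {1}"]) force+
  then show ?thesis
    by (subst AE_restrict_space_iff) auto
qed

lemma
  assumes "w \<in> H10"
  shows L2_wderiv: "L2 (wderiv w)"
    and H10_eq: "x \<in> {0..1} \<Longrightarrow> w x = ip (indicator {0..x}) (wderiv w)"
proof -
  have "\<exists>g. L2 g \<and> (\<forall>x\<in>{0..1}. w x = integral\<^sup>L (lebesgue_on {0..x}) g)"
    using assms by (auto simp: H10_def)
  from someI_ex[OF this]
  have "L2 (wderiv w) \<and> (\<forall>x\<in>{0..1}. w x = integral\<^sup>L (lebesgue_on {0..x}) (wderiv w))"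
    unfolding wderiv_def .
  then show "L2 (wderiv w)" "x \<in> {0..1} \<Longrightarrow> w x = ip (indicator {0..x}) (wderiv w)"
    by (simp_all add: integral_initial_eq_ip)
qed

text \<open>Being a choice, \<open>wderiv w\<close> is known only up to null sets. The formulas for
  derivatives below are obtained, directly or indirectly, by exhibiting a primitive and applying
  this.\<close>

lemma wderiv_AE_eq:
  assumes "w \<in> H10" "L2 g" "\<And>x. x \<in> {0..1} \<Longrightarrow> w x = ip (indicator {0..x}) g"
  shows "AE x in unit_measure. wderiv w x = g x"
proof -
  have "AE x in unit_measure. wderiv w x - g x = 0"
    using assms by (intro AE_0_of_primitive_0)
      (auto simp: L2_diff L2_wderiv ip_diff_right L2_indicator simp flip: H10_eq)
  then show ?thesis
    by simp
qed

lemma H10_zero_outside: "w \<in> H10 \<Longrightarrow> x \<notin> {0..1} \<Longrightarrow> w x = 0"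
  by (simp add: H10_def)

lemma H10I:
  assumes "L2 g" "\<And>x. x \<in> {0..1} \<Longrightarrow> w x = ip (indicator {0..x}) g" "w 1 = 0"
    "\<And>x. x \<notin> {0..1} \<Longrightarrow> w x = 0"
  shows "w \<in> H10"
  using assms by (auto simp: H10_def integral_initial_eq_ip intro!: exI[of _ g])

lemma ip_one_wderiv:
  assumes "w \<in> H10"
  shows "ip (\<lambda>_. 1) (wderiv w) = 0"
  using H10_eq[OF assms, of 1] assms by (simp add: ip_indicator_Icc_1 H10_def)

lemma H10_continuous:
  assumes "w \<in> H10"
  shows "continuous_on {0..1} w"
  using primitive_continuous[OF L2_wderiv[OF assms]]
  by (rule continuous_on_eq) (simp add: H10_eq[OF assms])

lemma H10_L2: "w \<in> H10 \<Longrightarrow> L2 w"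
  by (intro L2_continuous H10_continuous)

text \<open>The Hoelder bound measured from 0, where w vanishes; the constant is 1 because D has
  length one.\<close>

lemma H10_bound:
  assumes "w \<in> H10" "x \<in> {0..1}"
  shows "\<bar>w x\<bar> \<le> L2norm (wderiv w)"
proof -
  have "\<bar>w x\<bar> \<le> sqrt \<bar>x\<bar> * L2norm (wderiv w)"
    using primitive_Hoelder[OF L2_wderiv[OF assms(1)] assms(2), of 0] assms
    by (simp add: H10_eq[OF assms] ip_indicator_singleton)
  also have "\<dots> \<le> 1 * L2norm (wderiv w)"
    using assms(2) by (intro mult_right_mono) (auto simp: L2norm_nonneg)
  finally show ?thesis
    by simp
qed

text \<open>Poincare's inequality, read off from the sup bound since D has measure one.\<close>

lemma L2norm_le_wderiv:
  assumes "w \<in> H10"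
  shows "L2norm w \<le> L2norm (wderiv w)"
  using assms by (intro L2norm_bound) (auto simp: H10_bound L2norm_nonneg intro!: L2_measurable H10_L2)

lemma
  assumes "v \<in> H10" "w \<in> H10"
  shows H10_add: "(\<lambda>x. v x + w x) \<in> H10"
    and wderiv_add: "AE x in unit_measure. wderiv (\<lambda>x. v x + w x) x = wderiv v x + wderiv w x"
proof -
  have L: "L2 (\<lambda>x. wderiv v x + wderiv w x)"
    using assms by (intro L2_add L2_wderiv)
  have eq: "v x + w x = ip (indicator {0..x}) (\<lambda>x. wderiv v x + wderiv w x)" if "x \<in> {0..1}" for x
    using assms that by (subst ip_add_right) (simp_all add: L2_wderiv L2_indicator H10_eq[symmetric])
  show H: "(\<lambda>x. v x + w x) \<in> H10"
    by (rule H10I[OF L eq]) (use assms in \<open>auto simp: H10_def\<close>)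
  show "AE x in unit_measure. wderiv (\<lambda>x. v x + w x) x = wderiv v x + wderiv w x"
    by (rule wderiv_AE_eq[OF H L eq])
qed

lemma
  assumes "w \<in> H10"
  shows H10_cmult: "(\<lambda>x. c * w x) \<in> H10"
    and wderiv_cmult: "AE x in unit_measure. wderiv (\<lambda>x. c * w x) x = c * wderiv w x"
proof -
  have L: "L2 (\<lambda>x. c * wderiv w x)"
    using assms by (intro L2_cmult L2_wderiv)
  have eq: "c * w x = ip (indicator {0..x}) (\<lambda>x. c * wderiv w x)" if "x \<in> {0..1}" for x
    using assms that by (subst ip_cmult_right) (simp add: H10_eq[symmetric])
  show H: "(\<lambda>x. c * w x) \<in> H10"
    by (rule H10I[OF L eq]) (use assms in \<open>auto simp: H10_def\<close>)
  show "AE x in unit_measure. wderiv (\<lambda>x. c * w x) x = c * wderiv w x"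
    by (rule wderiv_AE_eq[OF H L eq])
qed

section \<open>Integration by parts\<close>

lemma pair_sigma_finite_unit: "pair_sigma_finite unit_measure unit_measure"
  by (intro pair_sigma_finite.intro finite_measure.axioms(1) finite_measure_unit)

text \<open>Both sides integrate g(s) v(t) over a triangle. On the left it is t <= s, which the zero
  mean of v trades, up to sign, for s < t; Fubini then produces the right-hand side.\<close>

lemma ip_primitive_swap:
  assumes g: "L2 g" and v: "L2 v" and mean: "ip (\<lambda>_. 1) v = 0"
  shows "ip g (\<lambda>x. ip (indicator {0..x}) v) = - ip (\<lambda>x. ip (indicator {0..x}) g) v"
proof -
  interpret pair_sigma_finite unit_measure unit_measure
    by (rule pair_sigma_finite_unit)
  have m [measurable]: "g \<in> borel_measurable unit_measure" "v \<in> borel_measurable unit_measure"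
    using g v by (auto simp: L2_def)
  have ident [measurable]: "(\<lambda>x. x) \<in> borel_measurable unit_measure"
    by (intro measurable_restrict_space1 measurable_completion) simp
  \<comment> \<open>The integrable majorant for the integrand cut off to the triangle.\<close>
  have gv: "integrable (unit_measure \<Otimes>\<^sub>M unit_measure) (\<lambda>(s, t). g s * v t)"
  proof (rule Fubini_integrable)
    show "integrable unit_measure (\<lambda>x. \<integral>y. norm (case (x, y) of (s, t) \<Rightarrow> g s * v t) \<partial>unit_measure)"
      using L2_integrable[OF g] by (simp add: abs_mult)
    show "AE x in unit_measure. integrable unit_measure (\<lambda>y. case (x, y) of (s, t) \<Rightarrow> g s * v t)"
      using L2_integrable[OF v] by simp
  qed simp
  have int: "integrable (unit_measure \<Otimes>\<^sub>M unit_measure) (\<lambda>(s, t). indicator {u. fst u < snd u} (s, t) * (g s * v t))"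
  proof (rule Bochner_Integration.integrable_bound[OF gv])
    have [measurable]: "Measurable.pred (unit_measure \<Otimes>\<^sub>M unit_measure) (\<lambda>u. fst u < snd u)"
      by (rule borel_measurable_pred_less)
        (auto intro: measurable_compose[OF measurable_fst ident] measurable_compose[OF measurable_snd ident])
    show "(\<lambda>(s, t). indicator {u. fst u < snd u} (s, t) * (g s * v t)) \<in> borel_measurable (unit_measure \<Otimes>\<^sub>M unit_measure)"
      unfolding indicator_def case_prod_beta mem_Collect_eq prod.collapse of_bool_def by measurable
  qed (auto simp: indicator_def)
  have upper: "ip (indicator {0..s}) v = - ip (indicator {s<..}) v" if "s \<in> {0..1}" for s
  proof -
    have "ip (indicator {0..s}) v = ip (\<lambda>t. 1 - indicator {s<..} t) v"
      unfolding ip_def by (rule Bochner_Integration.integral_cong) (use that in \<open>auto simp: indicator_def\<close>)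
    also have "\<dots> = - ip (indicator {s<..}) v"
      using mean v by (subst ip_diff_left) (auto simp: L2_const L2_indicator)
    finally show ?thesis .
  qed
  \<comment> \<open>The triangle is cut out by a strict inequality, so the closed interval has to
    give up its endpoint t, a null set.\<close>
  have lower: "ip (indicator {0..t}) g = ip (indicator {..<t}) g" if "t \<in> {0..1}" for t
  proof (rule ip_cong_AE)
    have "AE x in lebesgue. x \<in> {0..1} \<longrightarrow> indicat_real {0..t} x = indicator {..<t} x"
      by (rule AE_I'[of "{t}"]) (auto simp: indicator_def)
    then show "AE x in unit_measure. indicat_real {0..t} x = indicator {..<t} x"
      by (subst AE_restrict_space_iff) auto
  qed (auto simp: g L2_indicator)
  have "ip g (\<lambda>x. ip (indicator {0..x}) v) = (\<integral>s. g s * (- ip (indicator {s<..}) v) \<partial>unit_measure)"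
    unfolding ip_def[of g] by (rule Bochner_Integration.integral_cong) (use upper in auto)
  also have "\<dots> = - (\<integral>s. g s * ip (indicator {s<..}) v \<partial>unit_measure)"
    by simp
  also have "(\<integral>s. g s * ip (indicator {s<..}) v \<partial>unit_measure) =
     (\<integral>s. \<integral>t. indicator {u. fst u < snd u} (s, t) * (g s * v t) \<partial>unit_measure \<partial>unit_measure)"
    unfolding ip_def integral_mult_right_zero[symmetric]
    by (intro Bochner_Integration.integral_cong refl) (auto simp: indicator_def)
  also have "\<dots> = (\<integral>t. \<integral>s. indicator {u. fst u < snd u} (s, t) * (g s * v t) \<partial>unit_measure \<partial>unit_measure)"
    by (rule Fubini_integral[OF int, symmetric])
  also have "\<dots> = (\<integral>t. ip (indicator {..<t}) g * v t \<partial>unit_measure)"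
    unfolding ip_def integral_mult_left_zero[symmetric]
    by (intro Bochner_Integration.integral_cong refl) (auto simp: indicator_def)
  also have "\<dots> = ip (\<lambda>x. ip (indicator {0..x}) g) v"
    unfolding ip_def[of _ v] by (rule Bochner_Integration.integral_cong) (use lower in auto)
  finally show ?thesis .
qed

subsection \<open>The fractional derivative and the bilinear form\<close>

text \<open>Cut off beyond x, so that the fractional derivative becomes an inner product over all of
  D.\<close>

definition RL_kernel :: "real \<Rightarrow> real \<Rightarrow> real \<Rightarrow> real" where
  "RL_kernel \<alpha> x t = indicator {0..x} t * (x - t) powr (\<alpha> - 2)"

lemma RLD_eq:
  assumes "x \<in> {0..1}"
  shows "RLD \<alpha> w x = ip (RL_kernel \<alpha> x) (wderiv w) / Gamma (\<alpha> - 1)"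
  using integral_initial_eq_ip[OF assms, of "\<lambda>t. (x - t) powr (\<alpha> - 2) * wderiv w t"]
  by (simp add: RLD_def RL_kernel_def ip_def mult.assoc)

text \<open>The exponent 2 alpha - 4 exceeds -1 exactly when alpha > 3/2, and then the
  antiderivative is continuous up to t = x. The integrand may blow up there, so the fundamental
  theorem is used in the form that asks for a derivative in the interior only.\<close>

lemma RL_kernel_sq_has_integral:
  fixes \<alpha> x :: real
  assumes "3/2 < \<alpha>" "0 \<le> x"
  shows "((\<lambda>t. (x - t) powr (2 * \<alpha> - 4)) has_integral x powr (2 * \<alpha> - 3) / (2 * \<alpha> - 3)) {0..x}"
proof -
  have "((\<lambda>t. (x - t) powr (2 * \<alpha> - 4)) has_integral
      (- ((x - x) powr (2 * \<alpha> - 3)) / (2 * \<alpha> - 3)) - (- ((x - 0) powr (2 * \<alpha> - 3)) / (2 * \<alpha> - 3))) {0..x}"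
  proof (rule fundamental_theorem_of_calculus_interior)
    show "continuous_on {0..x} (\<lambda>t. - ((x - t) powr (2 * \<alpha> - 3)) / (2 * \<alpha> - 3))"
      using assms by (intro continuous_intros continuous_on_powr') auto
    fix t assume t: "t \<in> {0<..<x}"
    show "((\<lambda>t. - ((x - t) powr (2 * \<alpha> - 3)) / (2 * \<alpha> - 3)) has_vector_derivative (x - t) powr (2 * \<alpha> - 4)) (at t)"
    proof -
      have "((\<lambda>t. (x - t) powr (2 * \<alpha> - 3)) has_real_derivative
          (2 * \<alpha> - 3) * (x - t) powr (2 * \<alpha> - 3 - of_nat 1) * (- 1)) (at t)"
        using t by (intro DERIV_fun_powr) (auto intro!: derivative_eq_intros)
      from DERIV_cdivide[OF DERIV_minus[OF this], of "2 * \<alpha> - 3"] show ?thesis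
        using assms by (simp add: has_real_derivative_iff_has_vector_derivative)
    qed
  qed (use assms in auto)
  then show ?thesis
    using assms by simp
qed

lemma
  assumes "3/2 < \<alpha>" "x \<in> {0..1}"
  shows L2_RL_kernel: "L2 (RL_kernel \<alpha> x)"
    and L2norm_RL_kernel: "L2norm (RL_kernel \<alpha> x) \<le> 1 / sqrt (2 * \<alpha> - 3)"
proof -
  let ?k = "\<lambda>t. (x - t) powr (2 * \<alpha> - 4)"
  have ident [measurable]: "(\<lambda>x. x) \<in> borel_measurable unit_measure"
    by (intro measurable_restrict_space1 measurable_completion) simp
  have ind [measurable]: "indicat_real {0..x} \<in> borel_measurable unit_measure"
    by (rule L2_measurable[OF L2_indicator_Icc])
  \<comment> \<open>Nonnegativity upgrades gauge integrability to Lebesgue integrability.\<close>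
  have "?k absolutely_integrable_on {0..x}"
    using RL_kernel_sq_has_integral[OF assms(1), of x] assms(2)
    by (intro nonnegative_absolutely_integrable_1) (auto simp: integrable_on_def)
  then have int: "integrable (lebesgue_on {0..x}) ?k"
    by (simp add: set_integrable_def integrable_restrict_space)
  have sq: "(RL_kernel \<alpha> x t)\<^sup>2 = indicator {0..x} t * ?k t" for t
    by (simp add: RL_kernel_def indicator_def power2_eq_square flip: powr_add)
  have "integrable lebesgue (\<lambda>t. indicator {0..x} t *\<^sub>R ?k t)"
    using int by (simp add: integrable_restrict_space)
  then have "integrable lebesgue (\<lambda>t. indicator {0..1} t *\<^sub>R (indicator {0..x} t * ?k t))"
    by (rule Bochner_Integration.integrable_cong[THEN iffD1, rotated -1]) (use assms in \<open>auto simp: indicator_def\<close>)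
  then have int': "integrable unit_measure (\<lambda>t. indicator {0..x} t * ?k t)"
    by (subst integrable_restrict_space) auto
  show "L2 (RL_kernel \<alpha> x)"
    unfolding L2_def sq
  proof
    show "RL_kernel \<alpha> x \<in> borel_measurable unit_measure"
      unfolding RL_kernel_def by measurable
  qed (rule int')
  have "ip (RL_kernel \<alpha> x) (RL_kernel \<alpha> x) = ip (indicator {0..x}) ?k"
    unfolding ip_def by (simp add: sq flip: power2_eq_square)
  also have "\<dots> = integral {0..x} ?k"
    using assms(2) by (subst integral_initial_eq_ip[symmetric]) (auto intro: lebesgue_integral_eq_integral[OF int])
  also have "\<dots> = x powr (2 * \<alpha> - 3) / (2 * \<alpha> - 3)"
    using RL_kernel_sq_has_integral[OF assms(1), of x] assms(2) by (simp add: integral_unique)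
  also have "\<dots> \<le> 1 / (2 * \<alpha> - 3)"
    using assms by (intro divide_right_mono powr_le1) auto
  finally show "L2norm (RL_kernel \<alpha> x) \<le> 1 / sqrt (2 * \<alpha> - 3)"
    by (metis L2norm_def real_sqrt_divide real_sqrt_le_iff real_sqrt_one)
qed

definition RL_const :: "real \<Rightarrow> real" where
  "RL_const \<alpha> = 1 / (sqrt (2 * \<alpha> - 3) * Gamma (\<alpha> - 1))"

text \<open>The kernel norm is bounded uniformly in x. The resulting pointwise bound controls the
  function in L2 and also its value at 1, which an L2 bound could not do.\<close>

lemma RLD_bound:
  assumes "3/2 < \<alpha>" "x \<in> {0..1}" "w \<in> H10"
  shows "\<bar>RLD \<alpha> w x\<bar> \<le> RL_const \<alpha> * L2norm (wderiv w)"
proof -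
  have G: "Gamma (\<alpha> - 1) > 0"
    using assms by (intro Gamma_real_pos) auto
  have "\<bar>ip (RL_kernel \<alpha> x) (wderiv w)\<bar> \<le> L2norm (RL_kernel \<alpha> x) * L2norm (wderiv w)"
    using assms by (intro ip_Cauchy_Schwarz L2_RL_kernel L2_wderiv)
  also have "\<dots> \<le> 1 / sqrt (2 * \<alpha> - 3) * L2norm (wderiv w)"
    using assms by (intro mult_right_mono L2norm_RL_kernel L2norm_nonneg)
  finally have "\<bar>ip (RL_kernel \<alpha> x) (wderiv w)\<bar> / Gamma (\<alpha> - 1)
      \<le> 1 / sqrt (2 * \<alpha> - 3) * L2norm (wderiv w) / Gamma (\<alpha> - 1)"
    using G by (intro divide_right_mono) auto
  then show ?thesis
    using G by (simp add: RLD_eq[OF assms(2)] RL_const_def)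
qed

text \<open>Derivatives add only almost everywhere, but \<open>RLD\<close> integrates them; so
  equality holds at every point of [0,1], in particular at 1.\<close>

lemma RLD_add:
  assumes "3/2 < \<alpha>" "x \<in> {0..1}" "v \<in> H10" "w \<in> H10"
  shows "RLD \<alpha> (\<lambda>x. v x + w x) x = RLD \<alpha> v x + RLD \<alpha> w x"
proof -
  have "ip (RL_kernel \<alpha> x) (wderiv (\<lambda>x. v x + w x)) = ip (RL_kernel \<alpha> x) (\<lambda>x. wderiv v x + wderiv w x)"
    using assms by (intro ip_cong_AE wderiv_add L2_RL_kernel L2_wderiv L2_add H10_add) auto
  also have "\<dots> = ip (RL_kernel \<alpha> x) (wderiv v) + ip (RL_kernel \<alpha> x) (wderiv w)"
    using assms by (intro ip_add_right L2_RL_kernel L2_wderiv)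
  finally show ?thesis
    using assms(2) by (simp add: RLD_eq add_divide_distrib)
qed

lemma RLD_cmult:
  assumes "3/2 < \<alpha>" "x \<in> {0..1}" "w \<in> H10"
  shows "RLD \<alpha> (\<lambda>x. c * w x) x = c * RLD \<alpha> w x"
proof -
  have "ip (RL_kernel \<alpha> x) (wderiv (\<lambda>x. c * w x)) = ip (RL_kernel \<alpha> x) (\<lambda>x. c * wderiv w x)"
    using assms by (intro ip_cong_AE wderiv_cmult L2_RL_kernel L2_wderiv L2_cmult H10_cmult) auto
  then show ?thesis
    using assms(2) by (simp add: RLD_eq ip_cmult_right)
qed

text \<open>A parameter integral is measurable once kernel times derivative is jointly measurable in
  (x,t).\<close>

lemma RLD_measurable:
  assumes "w \<in> H10"
  shows "RLD \<alpha> w \<in> borel_measurable unit_measure"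
proof -
  interpret finite_measure unit_measure
    by (rule finite_measure_unit)
  have [measurable]: "wderiv w \<in> borel_measurable unit_measure"
    by (rule L2_measurable[OF L2_wderiv[OF assms]])
  have ident: "(\<lambda>x. x) \<in> borel_measurable unit_measure"
    by (intro measurable_restrict_space1 measurable_completion) simp
  have [measurable]: "fst \<in> borel_measurable (unit_measure \<Otimes>\<^sub>M unit_measure)"
    "snd \<in> borel_measurable (unit_measure \<Otimes>\<^sub>M unit_measure)"
    by (rule measurable_compose[OF measurable_fst ident] measurable_compose[OF measurable_snd ident])+
  have [measurable]: "Measurable.pred (unit_measure \<Otimes>\<^sub>M unit_measure) (\<lambda>u. 0 \<le> snd u \<and> snd u \<le> fst u)"
    by measurable
  have "(\<lambda>x. \<integral>t. RL_kernel \<alpha> x t * wderiv w t \<partial>unit_measure) \<in> borel_measurable unit_measure"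
  proof (rule borel_measurable_lebesgue_integral)
    show "(\<lambda>(x, t). RL_kernel \<alpha> x t * wderiv w t) \<in> borel_measurable (unit_measure \<Otimes>\<^sub>M unit_measure)"
      unfolding RL_kernel_def indicator_def case_prod_beta atLeastAtMost_iff of_bool_def by measurable
  qed
  then have "(\<lambda>x. ip (RL_kernel \<alpha> x) (wderiv w) / Gamma (\<alpha> - 1)) \<in> borel_measurable unit_measure"
    unfolding ip_def by measurable
  then show ?thesis
    by (rule measurable_cong[THEN iffD1, rotated]) (simp add: RLD_eq)
qed

lemma L2_RLD:
  assumes "3/2 < \<alpha>" "w \<in> H10"
  shows "L2 (RLD \<alpha> w)"
  using assms by (intro L2_bounded[OF RLD_measurable RLD_bound])

section \<open>The bilinear form and its lower-order term\<close>

locale fractional_form =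
  fixes \<alpha> :: real and q p :: "real \<Rightarrow> real"
  assumes \<alpha>: "3/2 < \<alpha>" and q: "Linf q" and p: "L2 p"
begin

definition lower_order :: "(real \<Rightarrow> real) \<Rightarrow> real \<Rightarrow> real" where
  "lower_order w x = q x * RLD \<alpha> w x + RLD \<alpha> w 1 * p x"

lemma L2_lower_order: "w \<in> H10 \<Longrightarrow> L2 (lower_order w)"
  unfolding lower_order_def
  by (intro L2_add L2_cmult L2_Linf_mult L2_RLD \<alpha> q p)

lemma Aform_eq:
  assumes "w \<in> H10" "v \<in> H10"
  shows "Aform \<alpha> q p w v = ip (wderiv w) (wderiv v) + ip (lower_order w) v"
proof -
  have "ip (lower_order w) v = ip (\<lambda>x. q x * RLD \<alpha> w x) v + ip (\<lambda>x. RLD \<alpha> w 1 * p x) v"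
    unfolding lower_order_def using assms
    by (intro ip_add_left L2_cmult L2_Linf_mult L2_RLD \<alpha> q p H10_L2)
  moreover have "ip (\<lambda>x. q x * RLD \<alpha> w x) v = ip (RLD \<alpha> w) (\<lambda>x. q x * v x)"
    by (simp add: ip_def mult_ac)
  ultimately show ?thesis
    by (simp add: Aform_def ip_cmult_left)
qed

lemma lower_order_add:
  "v \<in> H10 \<Longrightarrow> w \<in> H10 \<Longrightarrow> x \<in> {0..1} \<Longrightarrow>
    lower_order (\<lambda>x. v x + w x) x = lower_order v x + lower_order w x"
  using \<alpha> by (simp add: lower_order_def RLD_add algebra_simps)

lemma lower_order_cmult:
  "w \<in> H10 \<Longrightarrow> x \<in> {0..1} \<Longrightarrow> lower_order (\<lambda>x. c * w x) x = c * lower_order w x"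
  using \<alpha> by (simp add: lower_order_def RLD_cmult algebra_simps)

lemma Aform_add_left:
  assumes "v \<in> H10" "w \<in> H10" "u \<in> H10"
  shows "Aform \<alpha> q p (\<lambda>x. v x + w x) u = Aform \<alpha> q p v u + Aform \<alpha> q p w u"
proof -
  have "ip (wderiv (\<lambda>x. v x + w x)) (wderiv u) = ip (\<lambda>x. wderiv v x + wderiv w x) (wderiv u)"
    using assms by (intro ip_cong_AE wderiv_add L2_wderiv L2_add H10_add) auto
  moreover have "ip (lower_order (\<lambda>x. v x + w x)) u = ip (\<lambda>x. lower_order v x + lower_order w x) u"
    using assms by (intro ip_cong lower_order_add) auto
  ultimately show ?thesis
    using assms by (simp add: Aform_eq H10_add ip_add_left L2_wderiv L2_lower_order H10_L2)
qed

lemma Aform_cmult_left: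
  assumes "w \<in> H10" "u \<in> H10"
  shows "Aform \<alpha> q p (\<lambda>x. c * w x) u = c * Aform \<alpha> q p w u"
proof -
  have "ip (wderiv (\<lambda>x. c * w x)) (wderiv u) = ip (\<lambda>x. c * wderiv w x) (wderiv u)"
    using assms by (intro ip_cong_AE wderiv_cmult L2_wderiv L2_cmult H10_cmult) auto
  moreover have "ip (lower_order (\<lambda>x. c * w x)) u = ip (\<lambda>x. c * lower_order w x) u"
    using assms by (intro ip_cong lower_order_cmult) auto
  ultimately show ?thesis
    using assms by (simp add: Aform_eq H10_cmult ip_cmult_left algebra_simps)
qed

lemma Aform_add_right:
  assumes "v \<in> H10" "w \<in> H10" "u \<in> H10"
  shows "Aform \<alpha> q p u (\<lambda>x. v x + w x) = Aform \<alpha> q p u v + Aform \<alpha> q p u w"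
proof -
  have "ip (wderiv u) (wderiv (\<lambda>x. v x + w x)) = ip (wderiv u) (\<lambda>x. wderiv v x + wderiv w x)"
    using assms by (intro ip_cong_AE wderiv_add L2_wderiv L2_add H10_add) auto
  then show ?thesis
    using assms by (simp add: Aform_eq H10_add ip_add_right L2_wderiv L2_lower_order H10_L2)
qed

lemma Aform_cmult_right:
  assumes "w \<in> H10" "u \<in> H10"
  shows "Aform \<alpha> q p u (\<lambda>x. c * w x) = c * Aform \<alpha> q p u w"
proof -
  have "ip (wderiv u) (wderiv (\<lambda>x. c * w x)) = ip (wderiv u) (\<lambda>x. c * wderiv w x)"
    using assms by (intro ip_cong_AE wderiv_cmult L2_wderiv L2_cmult H10_cmult) auto
  then show ?thesis
    using assms by (simp add: Aform_eq H10_cmult ip_cmult_right algebra_simps)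
qed

lemma lower_order_bounded:
  obtains K where "K > 0" "\<And>w. w \<in> H10 \<Longrightarrow> L2norm (lower_order w) \<le> K * L2norm (wderiv w)"
proof -
  obtain C where C: "AE x in unit_measure. \<bar>q x\<bar> \<le> C"
    using q by (auto simp: Linf_def)
  define R where "R = RL_const \<alpha>"
  have "R \<ge> 0"
    using \<alpha> Gamma_real_pos[of "\<alpha> - 1"] by (simp add: R_def RL_const_def)
  define K where "K = \<bar>C\<bar> * R + R * L2norm p"
  have "L2norm (lower_order w) \<le> K * L2norm (wderiv w)" if w: "w \<in> H10" for w
  proof -
    let ?W = "L2norm (wderiv w)"
    have bd: "\<bar>RLD \<alpha> w x\<bar> \<le> R * ?W" if "x \<in> {0..1}" for x
      using RLD_bound[OF \<alpha> that w] by (simp add: R_def)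
    have "L2norm (\<lambda>x. q x * RLD \<alpha> w x) \<le> \<bar>C\<bar> * L2norm (RLD \<alpha> w)"
    proof (rule L2norm_AE_bound)
      show "AE x in unit_measure. \<bar>q x * RLD \<alpha> w x\<bar> \<le> \<bar>C\<bar> * \<bar>RLD \<alpha> w x\<bar>"
        using C by eventually_elim (auto simp: abs_mult intro: mult_right_mono)
    qed (auto intro!: L2_measurable L2_Linf_mult L2_RLD \<alpha> q w)
    also have "\<dots> \<le> \<bar>C\<bar> * (R * ?W)"
      using bd \<open>R \<ge> 0\<close> w by (intro mult_left_mono L2norm_bound RLD_measurable) (auto simp: L2norm_nonneg)
    finally have 1: "L2norm (\<lambda>x. q x * RLD \<alpha> w x) \<le> \<bar>C\<bar> * (R * ?W)" .
    have 2: "L2norm (\<lambda>x. RLD \<alpha> w 1 * p x) \<le> R * ?W * L2norm p"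
      using bd[of 1] by (simp add: L2norm_cmult mult_right_mono L2norm_nonneg)
    have "L2norm (lower_order w) \<le> L2norm (\<lambda>x. q x * RLD \<alpha> w x) + L2norm (\<lambda>x. RLD \<alpha> w 1 * p x)"
      unfolding lower_order_def by (intro L2norm_triangle L2_cmult L2_Linf_mult L2_RLD \<alpha> q p w)
    then show ?thesis
      using 1 2 by (simp add: K_def algebra_simps)
  qed
  \<comment> \<open>Enlarging the constant to \<open>\<bar>K\<bar> + 1\<close> makes it strictly
    positive; the proof of equicontinuity divides by it.\<close>
  then have "L2norm (lower_order w) \<le> (\<bar>K\<bar> + 1) * L2norm (wderiv w)" if "w \<in> H10" for w
    using that mult_right_mono[of K "\<bar>K\<bar> + 1" "L2norm (wderiv w)"] L2norm_nonneg[of "wderiv w"]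
    by fastforce
  then show ?thesis
    using that[of "\<bar>K\<bar> + 1"] by simp
qed

end

subsection \<open>The finite element space\<close>

lemma L2_sum: "finite I \<Longrightarrow> (\<And>i. i \<in> I \<Longrightarrow> L2 (f i)) \<Longrightarrow> L2 (\<lambda>x. \<Sum>i\<in>I. f i x)"
  by (induction I rule: finite_induct) (auto intro: L2_add L2_const)

lemma Linf_indicator: "A \<in> sets borel \<Longrightarrow> Linf (indicator A)"
  using L2_measurable[OF L2_indicator, of A]
  by (auto simp: Linf_def indicator_def intro!: exI[of _ 1])

text \<open>The cells are left-open, so that on the interval from \<open>xs i\<close> (excluded) to a point of the
  closed cell only the \<open>i\<close>-th piece is seen; the value at 0 is 0.\<close>

definition piecewise :: "nat \<Rightarrow> (nat \<Rightarrow> real) \<Rightarrow> (nat \<Rightarrow> real \<Rightarrow> real) \<Rightarrow> real \<Rightarrow> real" where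
  "piecewise N xs f x = (\<Sum>i<N. indicator {xs i<..xs (Suc i)} x * f i x)"

lemma L2_piecewise:
  assumes "\<And>i. i < N \<Longrightarrow> continuous_on {0..1} (f i)"
  shows "L2 (piecewise N xs f)"
  unfolding piecewise_def by (intro L2_sum L2_Linf_mult Linf_indicator L2_continuous assms) auto

lemma partition_mono:
  assumes "partition N xs" "i \<le> j" "j \<le> N"
  shows "xs i \<le> xs j"
  using assms(2,3)
proof (induction j rule: dec_induct)
  case (step n)
  then have "xs n < xs (Suc n)"
    using assms(1) by (auto simp: partition_def)
  then show ?case
    using step by simp
qed simp

lemma partition_in_unit:
  assumes "partition N xs" "i \<le> N"
  shows "xs i \<in> {0..1}"
  using partition_mono[OF assms(1), of 0 i] partition_mono[OF assms(1), of i N] assms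
  by (auto simp: partition_def)

lemma partition_piece_subset:
  assumes "partition N xs" "i < N"
  shows "{xs i..xs (Suc i)} \<subseteq> {0..1}"
  using partition_in_unit[OF assms(1), of i] partition_in_unit[OF assms(1), of "Suc i"] assms(2) by auto

lemma partition_locate:
  assumes "partition N xs" "x \<in> {0<..1}"
  obtains i where "i < N" "x \<in> {xs i<..xs (Suc i)}"
proof -
  define j where "j = (LEAST j. x \<le> xs j)"
  have N: "x \<le> xs N"
    using assms by (simp add: partition_def)
  have j: "x \<le> xs j"
    unfolding j_def by (rule LeastI[of _ N]) (rule N)
  have "j \<noteq> 0"
    using j assms by (intro notI) (simp add: partition_def)
  then obtain i where i: "j = Suc i"
    using not0_implies_Suc by blast
  have "xs i < x"
    using not_less_Least[of i "\<lambda>j. x \<le> xs j"] i by (simp add: j_def)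
  moreover have "i < N"
    using Least_le[of "\<lambda>j. x \<le> xs j" N] N i by (simp add: j_def)
  ultimately show ?thesis
    using that[of i] j i by simp
qed

lemma piecewise_eq:
  assumes "partition N xs" "i < N" "x \<in> {xs i<..xs (Suc i)}"
  shows "piecewise N xs f x = f i x"
proof -
  have "indicator {xs j<..xs (Suc j)} x * f j x = (if j = i then f i x else 0)" if "j < N" for j
  proof (cases j i rule: linorder_cases)
    case less
    then show ?thesis
      using partition_mono[OF assms(1), of "Suc j" i] assms(2,3) by auto
  next
    case greater
    then show ?thesis
      using partition_mono[OF assms(1), of "Suc i" j] assms(2,3) that by auto
  qed (use assms(3) in auto)
  then show ?thesis
    using assms(2) by (simp add: piecewise_def)
qed

lemma piecewise_0:
  assumes "partition N xs"
  shows "piecewise N xs f 0 = 0"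
  unfolding piecewise_def
proof (rule sum.neutral, rule ballI)
  fix i assume "i \<in> {..<N}"
  then show "indicator {xs i<..xs (Suc i)} 0 * f i 0 = 0"
    using partition_in_unit[OF assms, of i] by simp
qed

lemma mesh_ge:
  assumes "i < N"
  shows "xs (Suc i) - xs i \<le> mesh N xs"
  using assms by (auto simp: mesh_def intro!: Max_ge)

lemma Vh_add:
  assumes "v \<in> Vh k N xs" "w \<in> Vh k N xs"
  shows "(\<lambda>x. v x + w x) \<in> Vh k N xs"
proof -
  have "\<exists>R. degree R \<le> k + 1 \<and> (\<forall>x\<in>{xs i..xs (Suc i)}. v x + w x = poly R x)" if i: "i < N" for i
  proof -
    obtain P Q where "degree P \<le> k + 1" "\<forall>x\<in>{xs i..xs (Suc i)}. v x = poly P x"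
      "degree Q \<le> k + 1" "\<forall>x\<in>{xs i..xs (Suc i)}. w x = poly Q x"
      using assms i unfolding Vh_def by blast
    then show ?thesis
      by (intro exI[of _ "P + Q"]) (auto intro: degree_add_le)
  qed
  then show ?thesis
    using assms by (auto simp: Vh_def intro: continuous_on_add)
qed

lemma Vh_cmult:
  assumes "v \<in> Vh k N xs"
  shows "(\<lambda>x. c * v x) \<in> Vh k N xs"
proof -
  have "\<exists>R. degree R \<le> k + 1 \<and> (\<forall>x\<in>{xs i..xs (Suc i)}. c * v x = poly R x)" if i: "i < N" for i
  proof -
    obtain P where "degree P \<le> k + 1" "\<forall>x\<in>{xs i..xs (Suc i)}. v x = poly P x"
      using assms i unfolding Vh_def by blast
    then show ?thesis
      by (intro exI[of _ "smult c P"]) (auto intro: order.trans[OF degree_smult_le])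
  qed
  then show ?thesis
    using assms by (auto simp: Vh_def intro: continuous_on_mult_left)
qed

lemma Vh_polys:
  assumes "v \<in> Vh k N xs"
  obtains P where "\<And>i. i < N \<Longrightarrow> degree (P i) \<le> k + 1"
    "\<And>i x. i < N \<Longrightarrow> x \<in> {xs i..xs (Suc i)} \<Longrightarrow> v x = poly (P i) x"
proof -
  have "\<forall>i. \<exists>P. i < N \<longrightarrow> degree P \<le> k + 1 \<and> (\<forall>x\<in>{xs i..xs (Suc i)}. v x = poly P x)"
    using assms unfolding Vh_def by blast
  then obtain P where "\<And>i. i < N \<Longrightarrow> degree (P i) \<le> k + 1 \<and> (\<forall>x\<in>{xs i..xs (Suc i)}. v x = poly (P i) x)"
    by metis
  then show ?thesis
    using that[of P] by blast
qed

text \<open>The derivative taken cell by cell is a weak derivative: v is continuous, and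
  differentiable off the finitely many nodes, an exceptional set that the fundamental theorem
  tolerates.\<close>

lemma Vh_subset_H10:
  assumes part: "partition N xs"
  shows "Vh k N xs \<subseteq> H10"
proof
  fix v assume v: "v \<in> Vh k N xs"
  then obtain P where P: "\<And>i x. i < N \<Longrightarrow> x \<in> {xs i..xs (Suc i)} \<Longrightarrow> v x = poly (P i) x"
    by (rule Vh_polys) blast
  define g where "g = piecewise N xs (\<lambda>i. poly (pderiv (P i)))"
  have g: "L2 g"
    unfolding g_def by (intro L2_piecewise continuous_intros)
  have "v x = ip (indicator {0..x}) g" if x: "x \<in> {0..1}" for x
  proof -
    have "(g has_integral v x - v 0) {0..x}"
    proof (rule fundamental_theorem_of_calculus_interior_strong[of "xs ` {..N}"])
      fix t assume t: "t \<in> {0<..<x} - xs ` {..N}"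
      then obtain i where i: "i < N" "t \<in> {xs i<..xs (Suc i)}"
        using x by (auto intro: partition_locate[OF part, of t])
      \<comment> \<open>Off the nodes, t is interior to its cell, so v agrees with the polynomial on
        an open neighbourhood.\<close>
      have ti: "t \<in> {xs i<..<xs (Suc i)}"
        using i t by (cases "t = xs (Suc i)") auto
      have "(poly (P i) has_real_derivative g t) (at t)"
        using piecewise_eq[OF part i] by (simp add: g_def poly_DERIV)
      then have "(v has_real_derivative g t) (at t)"
        by (rule has_field_derivative_transform_within_open[where S = "{xs i<..<xs (Suc i)}"])
          (use ti P[OF i(1)] in auto)
      then show "(v has_vector_derivative g t) (at t)"
        by (simp add: has_real_derivative_iff_has_vector_derivative)
    next
      show "continuous_on {0..x} v"
        using v x by (auto simp: Vh_def elim!: continuous_on_subset)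
    qed (use x in auto)
    moreover have "integrable (lebesgue_on {0..x}) g"
      using x by (intro integrable_subinterval[OF L2_integrable[OF g]]) auto
    ultimately have "integral\<^sup>L (lebesgue_on {0..x}) g = v x"
      using v by (simp add: lebesgue_integral_eq_integral integral_unique Vh_def)
    then show ?thesis
      by (simp add: integral_initial_eq_ip[OF x])
  qed
  then show "v \<in> H10"
    using g v by (intro H10I[of g]) (auto simp: Vh_def)
qed

text \<open>Supplies the discrete functions for the comparison with the flux. The primitive of a
  step function is continuous and piecewise affine, and removing the mean makes it vanish at
  1.\<close>

lemma step_primitive_in_Vh:
  fixes a :: "nat \<Rightarrow> real"
  assumes part: "partition N xs"
  defines "s \<equiv> piecewise N xs (\<lambda>i _. a i)"
  obtains v where "v \<in> Vh k N xs" "AE x in unit_measure. wderiv v x = s x - ip (\<lambda>_. 1) s"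
proof -
  define m where "m = ip (\<lambda>_. 1) s"
  define g where "g = (\<lambda>x. s x - m)"
  have s: "L2 s"
    unfolding s_def by (intro L2_piecewise continuous_intros)
  have g: "L2 g"
    unfolding g_def by (intro L2_diff L2_const s)
  define v where "v x = (if x \<in> {0..1} then ip (indicator {0..x}) g else 0)" for x
  have v_eq: "v x = ip (indicator {0..x}) g" if "x \<in> {0..1}" for x
    using that by (simp add: v_def)
  have "ip (\<lambda>_. 1) (\<lambda>_. m) = m"
    by (simp add: ip_def measure_restrict_space)
  then have "ip (\<lambda>_. 1) g = 0"
    unfolding g_def by (simp add: ip_diff_right L2_const s m_def)
  then have v1: "v 1 = 0"
    by (simp add: v_def ip_indicator_Icc_1)
  have v0: "v 0 = 0"
    by (simp add: v_def ip_indicator_singleton)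
  have cont: "continuous_on {0..1} v"
    using primitive_continuous[OF g] by (rule continuous_on_eq) (simp add: v_def)
  have poly: "\<exists>P. degree P \<le> k + 1 \<and> (\<forall>x\<in>{xs i..xs (Suc i)}. v x = poly P x)" if i: "i < N" for i
  proof (intro exI conjI ballI)
    \<comment> \<open>The line of slope \<open>a i - m\<close> through the value of v at the left
      node.\<close>
    let ?P = "[: v (xs i) - (a i - m) * xs i, a i - m :]"
    show "degree ?P \<le> k + 1"
      by simp
    fix x assume x: "x \<in> {xs i..xs (Suc i)}"
    have rng: "0 \<le> xs i" "x \<le> 1" "xs i \<in> {0..1}" "x \<in> {0..1}"
      using partition_piece_subset[OF part i] x partition_in_unit[OF part, of i] i by auto
    have "v x - v (xs i) = ip (indicator {xs i<..x}) g"
      using rng x g by (simp add: v_eq ip_indicator_diff)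
    \<comment> \<open>On the left-open cell g is the constant \<open>a i - m\<close>; the length of
      the interval is left over, written as the squared norm of its indicator.\<close>
    also have "\<dots> = (a i - m) * ip (indicator {xs i<..x}) (indicator {xs i<..x})"
      unfolding ip_def integral_mult_right_zero[symmetric]
    proof (rule Bochner_Integration.integral_cong)
      fix y
      show "indicator {xs i<..x} y * g y = (a i - m) * (indicat_real {xs i<..x} y * indicator {xs i<..x} y)"
        using piecewise_eq[OF part i, of y] x by (auto simp: indicator_def g_def s_def)
    qed simp
    also have "ip (indicator {xs i<..x}) (indicator {xs i<..x}) = x - xs i"
      using L2norm_indicator_interval[of "xs i" x] rng x by (simp add: L2norm_def)
    finally show "v x = poly ?P x"
      by (simp add: algebra_simps)
  qed
  have "v \<in> Vh k N xs"
    using cont v0 v1 poly by (auto simp: Vh_def v_def)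
  moreover have "v \<in> H10"
    by (rule H10I[OF g v_eq v1]) (auto simp: v_def)
  then have "AE x in unit_measure. wderiv v x = s x - ip (\<lambda>_. 1) s"
    using wderiv_AE_eq[OF _ g v_eq] by (simp add: g_def m_def)
  ultimately show ?thesis
    by (rule that)
qed

subsection \<open>Linear problems in finite-dimensional function spaces\<close>

text \<open>Discrete spaces are sets of functions rather than types, so spans and independence are
  taken in the space of all functions with pointwise operations.\<close>

interpretation fun_vs: vector_space "\<lambda>(c::real) (f::'a \<Rightarrow> real) x. c * f x"
  by unfold_locales (auto simp: fun_eq_iff algebra_simps)

lemma sum_fun_apply: "(\<Sum>i\<in>I. f i) x = (\<Sum>i\<in>I. f i x :: real)"
  by (induction I rule: infinite_finite_induct) auto

lemma subspace_sum:
  assumes "finite I" "\<And>i. i \<in> I \<Longrightarrow> f i \<in> W" "(\<lambda>x. 0) \<in> W"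
    and add: "\<And>u v. u \<in> W \<Longrightarrow> v \<in> W \<Longrightarrow> (\<lambda>x. u x + v x) \<in> W"
    and cmult: "\<And>c v. v \<in> W \<Longrightarrow> (\<lambda>x. c * v x) \<in> W"
  shows "(\<lambda>x. \<Sum>i\<in>I. (c i :: real) * f i x) \<in> W"
  using assms(1,2)
proof (induction I rule: finite_induct)
  case (insert i I)
  then show ?case
    using add[OF cmult[of "f i" "c i"], of "\<lambda>x. \<Sum>i\<in>I. c i * f i x"] by simp
qed (simp add: assms(3))

text \<open>L is linear on \<open>W\<close> only, so every partial sum has to be kept inside
  \<open>W\<close>.\<close>

lemma linear_functional_sum:
  fixes L :: "('a \<Rightarrow> real) \<Rightarrow> real"
  assumes "finite I" "\<And>i. i \<in> I \<Longrightarrow> f i \<in> W" "(\<lambda>x. 0) \<in> W"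
    and add: "\<And>u v. u \<in> W \<Longrightarrow> v \<in> W \<Longrightarrow> (\<lambda>x. u x + v x) \<in> W"
    and cmult: "\<And>c v. v \<in> W \<Longrightarrow> (\<lambda>x. c * v x) \<in> W"
    and L_add: "\<And>u v. u \<in> W \<Longrightarrow> v \<in> W \<Longrightarrow> L (\<lambda>x. u x + v x) = L u + L v"
    and L_cmult: "\<And>c v. v \<in> W \<Longrightarrow> L (\<lambda>x. c * v x) = c * L v"
  shows "L (\<lambda>x. \<Sum>i\<in>I. c i * f i x) = (\<Sum>i\<in>I. c i * L (f i))"
  using assms(1,2)
proof (induction I rule: finite_induct)
  case empty
  show ?case
    using L_cmult[OF assms(3), of 0] by simp
next
  case (insert i I)
  have "(\<lambda>x. \<Sum>i\<in>I. c i * f i x) \<in> W"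
    using insert by (intro subspace_sum assms(3-5)) auto
  then show ?case
    using insert L_add[OF cmult[of "f i" "c i"], of "\<lambda>x. \<Sum>i\<in>I. c i * f i x"] by (simp add: L_cmult)
qed

text \<open>An injective square linear system is solvable. Take a finite basis \<open>C\<close> of
  \<open>W\<close>. The vectors of pairings of its elements with \<open>C\<close> are independent by
  injectivity and as numerous as the coordinates, so they span the coordinate space and reach the
  data F.\<close>

lemma finite_dim_solvable:
  fixes A :: "('a \<Rightarrow> real) \<Rightarrow> ('a \<Rightarrow> real) \<Rightarrow> real" and F :: "('a \<Rightarrow> real) \<Rightarrow> real"
  assumes zero: "(\<lambda>x. 0) \<in> W"
    and add: "\<And>u v. u \<in> W \<Longrightarrow> v \<in> W \<Longrightarrow> (\<lambda>x. u x + v x) \<in> W"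
    and cmult: "\<And>c v. v \<in> W \<Longrightarrow> (\<lambda>x. c * v x) \<in> W"
    and A_add1: "\<And>u v z. u \<in> W \<Longrightarrow> v \<in> W \<Longrightarrow> z \<in> W \<Longrightarrow> A (\<lambda>x. u x + v x) z = A u z + A v z"
    and A_cmult1: "\<And>c v z. v \<in> W \<Longrightarrow> z \<in> W \<Longrightarrow> A (\<lambda>x. c * v x) z = c * A v z"
    and A_add2: "\<And>u v z. u \<in> W \<Longrightarrow> v \<in> W \<Longrightarrow> z \<in> W \<Longrightarrow> A z (\<lambda>x. u x + v x) = A z u + A z v"
    and A_cmult2: "\<And>c v z. v \<in> W \<Longrightarrow> z \<in> W \<Longrightarrow> A z (\<lambda>x. c * v x) = c * A z v"
    and F_add: "\<And>u v. u \<in> W \<Longrightarrow> v \<in> W \<Longrightarrow> F (\<lambda>x. u x + v x) = F u + F v"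
    and F_cmult: "\<And>c v. v \<in> W \<Longrightarrow> F (\<lambda>x. c * v x) = c * F v"
    and inj: "\<And>w. w \<in> W \<Longrightarrow> (\<forall>v\<in>W. A w v = 0) \<Longrightarrow> w = (\<lambda>x. 0)"
    and fin: "finite B" "W \<subseteq> fun_vs.span B"
  shows "\<exists>w\<in>W. \<forall>v\<in>W. A w v = F v"
proof -
  \<comment> \<open>The generators in \<open>B\<close> may lie outside \<open>W\<close>; a basis is
    drawn from \<open>W\<close> itself, and \<open>B\<close> only bounds its size.\<close>
  obtain C where C: "C \<subseteq> W" "fun_vs.independent C" "W \<subseteq> fun_vs.span C"
    using fun_vs.maximal_independent_subset[of W] by blast
  have finC: "finite C"
    using fun_vs.independent_span_bound[OF fin(1) C(2)] C(1) fin(2) by blast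
  have CW: "u \<in> W" if "u \<in> C" for u
    using C(1) that by blast
  have comb: "(\<lambda>x. \<Sum>u\<in>C. c u * u x) \<in> W" for c :: "('a \<Rightarrow> real) \<Rightarrow> real"
    by (rule subspace_sum[where f = "\<lambda>u. u" and W = W]) (assumption | rule finC CW zero add cmult)+
  have A_comb1: "A (\<lambda>x. \<Sum>u\<in>C. c u * u x) z = (\<Sum>u\<in>C. c u * A u z)" if z: "z \<in> W" for c z
    by (rule linear_functional_sum[where L = "\<lambda>w. A w z" and f = "\<lambda>u. u" and W = W])
      (assumption | rule finC CW zero add cmult A_add1 A_cmult1 z)+
  have repr: "\<exists>c. v = (\<lambda>x. \<Sum>u\<in>C. c u * u x)" if "v \<in> W" for v
  proof -
    have "v \<in> range (\<lambda>c. \<Sum>u\<in>C. (\<lambda>x. c u * u x))"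
      using that C(3) fun_vs.span_finite[OF finC] by blast
    then show ?thesis
      by (auto simp: fun_eq_iff sum_fun_apply)
  qed
  \<comment> \<open>The factor b serves two uses: b = 0 for injectivity and b = 1 for the
    solution.\<close>
  have test: "\<forall>v\<in>W. A w v = b * F v" if w: "w \<in> W" and C_eq: "\<And>v. v \<in> C \<Longrightarrow> A w v = b * F v" for w b
  proof
    fix v assume "v \<in> W"
    then obtain c where v: "v = (\<lambda>x. \<Sum>u\<in>C. c u * u x)"
      using repr by blast
    have "A w v = (\<Sum>u\<in>C. c u * A w u)"
      unfolding v
      by (rule linear_functional_sum[where L = "\<lambda>v. A w v" and f = "\<lambda>u. u" and W = W])
        (assumption | rule finC CW zero add cmult A_add2 A_cmult2 w)+
    moreover have "F v = (\<Sum>u\<in>C. c u * F u)"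
      unfolding v
      by (rule linear_functional_sum[where L = F and f = "\<lambda>u. u" and W = W])
        (assumption | rule finC CW zero add cmult F_add F_cmult)+
    ultimately show "A w v = b * F v"
      by (simp add: C_eq sum_distrib_left mult_ac)
  qed
  \<comment> \<open>Coordinate vectors indexed by \<open>C\<close> are encoded as functions
    vanishing off \<open>C\<close>, so the same vector space structure applies. \<open>T w\<close>
    collects the pairings of w with the basis, and \<open>D\<close> consists of the unit
    vectors.\<close>
  define T where "T w = (\<lambda>v. if v \<in> C then A w v else 0)" for w
  define D where "D = (\<lambda>u v. if v = u then 1 else 0 :: real) ` C"
  have D_span: "f \<in> fun_vs.span D" if "\<And>v. v \<notin> C \<Longrightarrow> f v = 0" for f :: "('a \<Rightarrow> real) \<Rightarrow> real"
  proof -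
    have "f = (\<Sum>u\<in>C. (\<lambda>v. f u * (if v = u then 1 else 0)))"
    proof
      fix v
      show "f v = (\<Sum>u\<in>C. (\<lambda>v. f u * (if v = u then 1 else 0))) v"
        unfolding sum_fun_apply using that[of v] finC
        by (simp add: if_distrib[of "(*) _"] cong: if_cong)
    qed
    also have "\<dots> \<in> fun_vs.span D"
      by (intro fun_vs.span_sum fun_vs.span_scale fun_vs.span_base) (auto simp: D_def)
    finally show ?thesis .
  qed
  \<comment> \<open>A vanishing combination of the vectors \<open>T u\<close> gives an element of
    \<open>W\<close> that pairs to zero with all of \<open>W\<close>. Injectivity makes it 0, and
    independence of \<open>C\<close> then kills the coefficients.\<close>
  have null: "c u = 0" if "(\<Sum>u\<in>C. (\<lambda>v. c u * T u v)) = 0" "u \<in> C" for c u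
  proof -
    have "A (\<lambda>x. \<Sum>u\<in>C. c u * u x) v = 0" if "v \<in> C" for v
      using fun_cong[OF \<open>(\<Sum>u\<in>C. (\<lambda>v. c u * T u v)) = 0\<close>, of v] that CW
      by (simp add: sum_fun_apply T_def A_comb1)
    then have "(\<lambda>x. \<Sum>u\<in>C. c u * u x) = (\<lambda>x. 0)"
      using test[OF comb, of c 0] by (intro inj comb) auto
    then have "(\<Sum>u\<in>C. (\<lambda>x. c u * u x)) = 0"
      by (simp add: fun_eq_iff sum_fun_apply)
    then show ?thesis
      using C(2) finC that(2) fun_vs.dependent_finite[OF finC] by blast
  qed
  have inj_T: "inj_on T C"
  proof (rule inj_onI, rule ccontr)
    fix u u' assume u: "u \<in> C" "u' \<in> C" "T u = T u'" "u \<noteq> u'"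
    let ?c = "\<lambda>z. if z = u then 1 else if z = u' then -1 else 0 :: real"
    have "(\<Sum>z\<in>C. (\<lambda>v. ?c z * T z v)) = 0"
    proof
      fix v
      have "(\<Sum>z\<in>C. ?c z * T z v) = (\<Sum>z\<in>{u, u'}. ?c z * T z v)"
        using u finC by (intro sum.mono_neutral_right) auto
      then show "(\<Sum>z\<in>C. (\<lambda>v. ?c z * T z v)) v = 0 v"
        using u by (simp add: sum_fun_apply)
    qed
    from null[OF this u(1)] show False
      by simp
  qed
  have finT: "finite (T ` C)"
    using finC by simp
  have indep: "fun_vs.independent (T ` C)"
  proof
    assume "fun_vs.dependent (T ` C)"
    then obtain c y where y: "y \<in> T ` C" "c y \<noteq> 0" "(\<Sum>y\<in>T ` C. (\<lambda>v. c y * y v)) = 0"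
      using fun_vs.dependent_finite[OF finT] by blast
    then show False
      using null[of "\<lambda>u. c (T u)"] by (auto simp: sum.reindex[OF inj_T] o_def)
  qed
  define G where "G = (\<lambda>v. if v \<in> C then F v else 0)"
  have "G \<in> fun_vs.span (T ` C)"
  proof (rule ccontr)
    \<comment> \<open>Otherwise card C + 1 independent vectors would lie in the span of at most card
      C unit vectors.\<close>
    assume G: "G \<notin> fun_vs.span (T ` C)"
    then have "fun_vs.independent (insert G (T ` C))"
      using indep by (simp add: fun_vs.independent_insertI)
    moreover have "insert G (T ` C) \<subseteq> fun_vs.span D"
      by (auto intro!: D_span simp: G_def T_def)
    ultimately have "card (insert G (T ` C)) \<le> card D"
      using fun_vs.independent_span_bound[of D] finC by (simp add: D_def)
    also have "card D \<le> card C"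
      unfolding D_def by (rule card_image_le[OF finC])
    finally have "card (insert G (T ` C)) \<le> card C" .
    moreover have "G \<notin> T ` C"
      using G fun_vs.span_base[of G "T ` C"] by argo
    ultimately show False
      using finT by (simp add: card_image[OF inj_T])
  qed
  then have "G \<in> range (\<lambda>c. \<Sum>y\<in>T ` C. (\<lambda>v. c y * y v))"
    by (simp only: fun_vs.span_finite[OF finT])
  then obtain c where "G = (\<Sum>y\<in>T ` C. (\<lambda>v. c y * y v))"
    by (rule rangeE)
  then have c: "G = (\<Sum>u\<in>C. (\<lambda>v. c (T u) * T u v))"
    by (simp add: sum.reindex[OF inj_T])
  let ?w = "\<lambda>x. \<Sum>u\<in>C. c (T u) * u x"
  have "A ?w v = 1 * F v" if "v \<in> C" for v
    using fun_cong[OF c, of v] that CW[OF that]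
    by (simp add: G_def T_def sum_fun_apply A_comb1)
  then have "\<forall>v\<in>W. A ?w v = F v"
    using test[OF comb, of "\<lambda>u. c (T u)" 1] by simp
  then show ?thesis
    by (intro bexI[of _ ?w] comb)
qed

text \<open>Monomials cut off to single cells are in general discontinuous and outside
  \<open>Vh\<close>, but a finite set whose span contains \<open>Vh\<close> is all that solvability
  requires.\<close>

lemma Vh_finite_span:
  assumes part: "partition N xs"
  obtains B where "finite B" "Vh k N xs \<subseteq> fun_vs.span B"
proof
  define e where "e i d = (\<lambda>x. indicator {xs i<..xs (Suc i)} x * x ^ d)" for i d :: nat
  define B where "B = (\<lambda>(i, d). e i d) ` ({..<N} \<times> {..k + 1})"
  show "finite B"
    by (simp add: B_def)
  show "Vh k N xs \<subseteq> fun_vs.span B"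
  proof
    fix v assume v: "v \<in> Vh k N xs"
    then obtain P where P: "\<And>i. i < N \<Longrightarrow> degree (P i) \<le> k + 1"
      "\<And>i x. i < N \<Longrightarrow> x \<in> {xs i..xs (Suc i)} \<Longrightarrow> v x = poly (P i) x"
      by (rule Vh_polys) blast
    have P_eq: "poly (P i) x = (\<Sum>d\<le>k + 1. coeff (P i) d * x ^ d)" if "i < N" for i x
      unfolding poly_altdef using P(1)[OF that]
      by (intro sum.mono_neutral_left) (auto simp: coeff_eq_0)
    have v_eq: "v x = piecewise N xs (\<lambda>i. poly (P i)) x" for x
    proof (cases "x \<in> {0<..1}")
      case True
      then obtain i where "i < N" "x \<in> {xs i<..xs (Suc i)}"
        by (rule partition_locate[OF part])
      then show ?thesis
        using P(2)[of i x] by (simp add: piecewise_eq[OF part])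
    next
      \<comment> \<open>At 0 and outside [0,1] no left-open cell contains x, and v vanishes there
        too.\<close>
      case False
      then have "v x = 0"
        using v by (cases "x = 0") (auto simp: Vh_def)
      moreover have "indicat_real {xs i<..xs (Suc i)} x = 0" if "i < N" for i
        using partition_piece_subset[OF part that] False partition_in_unit[OF part, of i] that
        by (auto simp: indicator_def)
      ultimately show ?thesis
        by (simp add: piecewise_def)
    qed
    have "v = (\<Sum>i<N. \<Sum>d\<le>k + 1. (\<lambda>x. coeff (P i) d * e i d x))"
    proof
      fix x
      show "v x = (\<Sum>i<N. \<Sum>d\<le>k + 1. (\<lambda>x. coeff (P i) d * e i d x)) x"
        unfolding v_eq piecewise_def sum_fun_apply
        by (intro sum.cong refl) (simp add: P_eq sum_distrib_left e_def mult_ac del: sum.atMost_Suc)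
    qed
    also have "\<dots> \<in> fun_vs.span B"
      by (intro fun_vs.span_sum fun_vs.span_scale fun_vs.span_base) (auto simp: B_def)
    finally show "v \<in> fun_vs.span B" .
  qed
qed

subsection \<open>Approximation of the flux\<close>

lemma ip_eq_neg_primitive:
  assumes "L2 g" "v \<in> H10"
  shows "ip g v = - ip (\<lambda>x. ip (indicator {0..x}) g) (wderiv v)"
proof -
  have "ip g v = ip g (\<lambda>x. ip (indicator {0..x}) (wderiv v))"
    using assms(2) by (intro ip_cong H10_eq) auto
  then show ?thesis
    using ip_primitive_swap[OF assms(1) L2_wderiv[OF assms(2)] ip_one_wderiv[OF assms(2)]] by simp
qed

lemma primitive_bound:
  assumes "L2 g" "x \<in> {0..1}"
  shows "\<bar>ip (indicator {0..x}) g\<bar> \<le> L2norm g"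
proof -
  have "\<bar>ip (indicator {0..x}) g\<bar> \<le> sqrt \<bar>x\<bar> * L2norm g"
    using primitive_Hoelder[OF assms, of 0] assms(2) by (simp add: ip_indicator_singleton)
  also have "\<dots> \<le> 1 * L2norm g"
    using assms(2) by (intro mult_right_mono) (auto simp: L2norm_nonneg)
  finally show ?thesis
    by simp
qed

lemma mesh_nonneg:
  assumes "partition N xs"
  shows "0 \<le> mesh N xs"
  using partition_mono[OF assms, of 0 1] mesh_ge[of 0 N xs] assms by (simp add: partition_def)

text \<open>On each cell the primitive is frozen at the left node, at distance at most the mesh
  size, and the Hoelder bound gives the error.\<close>

lemma step_approximation:
  assumes part: "partition N xs" and g: "L2 g"
  defines "G \<equiv> \<lambda>x. ip (indicator {0..x}) g"
  defines "s \<equiv> piecewise N xs (\<lambda>i _. G (xs i))"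
  assumes x: "x \<in> {0..1}"
  shows "\<bar>s x - G x\<bar> \<le> sqrt (mesh N xs) * L2norm g" and "\<bar>s x\<bar> \<le> L2norm g"
proof -
  have *: "\<bar>s x - G x\<bar> \<le> sqrt (mesh N xs) * L2norm g \<and> \<bar>s x\<bar> \<le> L2norm g"
  proof (cases "x = 0")
    \<comment> \<open>0 lies in no left-open cell, so s(0) = 0; this agrees with G(0) = 0.\<close>
    case True
    then show ?thesis
      using mesh_nonneg[OF part] by (simp add: s_def G_def piecewise_0[OF part] ip_indicator_singleton L2norm_nonneg)
  next
    case False
    then obtain i where i: "i < N" "x \<in> {xs i<..xs (Suc i)}"
      using x partition_locate[OF part, of x] by auto
    have xi: "xs i \<in> {0..1}"
      using partition_in_unit[OF part] i(1) by simp
    have "\<bar>G (xs i) - G x\<bar> \<le> sqrt \<bar>xs i - x\<bar> * L2norm g"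
      unfolding G_def by (rule primitive_Hoelder[OF g xi x])
    also have "\<dots> \<le> sqrt (mesh N xs) * L2norm g"
      using i mesh_ge[OF i(1), of xs] by (intro mult_right_mono) (auto simp: L2norm_nonneg)
    finally have "\<bar>G (xs i) - G x\<bar> \<le> sqrt (mesh N xs) * L2norm g" .
    moreover have "\<bar>G (xs i)\<bar> \<le> L2norm g"
      unfolding G_def by (rule primitive_bound[OF g xi])
    ultimately show ?thesis
      using piecewise_eq[OF part i] by (simp add: s_def)
  qed
  show "\<bar>s x - G x\<bar> \<le> sqrt (mesh N xs) * L2norm g" "\<bar>s x\<bar> \<le> L2norm g"
    using * by simp_all
qed

lemma
  assumes "v \<in> H10" "w \<in> H10"
  shows H10_diff: "(\<lambda>x. v x - w x) \<in> H10"
    and wderiv_diff: "AE x in unit_measure. wderiv (\<lambda>x. v x - w x) x = wderiv v x - wderiv w x"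
proof -
  have eq: "(\<lambda>x. v x + (-1) * w x) = (\<lambda>x. v x - w x)"
    by simp
  show "(\<lambda>x. v x - w x) \<in> H10"
    using H10_add[OF assms(1) H10_cmult[OF assms(2), of "-1"]] by (simp only: eq)
  have "AE x in unit_measure. wderiv (\<lambda>x. v x + (-1) * w x) x = wderiv v x + wderiv (\<lambda>x. (-1) * w x) x"
    by (rule wderiv_add[OF assms(1) H10_cmult[OF assms(2)]])
  moreover have "AE x in unit_measure. wderiv (\<lambda>x. (-1) * w x) x = (-1) * wderiv w x"
    by (rule wderiv_cmult[OF assms(2)])
  ultimately show "AE x in unit_measure. wderiv (\<lambda>x. v x - w x) x = wderiv v x - wderiv w x"
    unfolding eq by eventually_elim simp
qed

lemma Vh_diff:
  assumes "v \<in> Vh k N xs" "w \<in> Vh k N xs"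
  shows "(\<lambda>x. v x - w x) \<in> Vh k N xs"
  using Vh_add[OF assms(1) Vh_cmult[OF assms(2), of "-1"]] by simp

lemma L2norm_cong_AE:
  assumes "AE x in unit_measure. f x = g x" "L2 f" "L2 g"
  shows "L2norm f = L2norm g"
  using ip_cong_AE[OF assms(1,1)] assms by (simp add: L2norm_def)

lemma ip_one_const: "ip (\<lambda>_. c) v = c * ip (\<lambda>_. 1) v"
  using ip_cmult_left[of c "\<lambda>_. 1" v] by simp

context fractional_form
begin

abbreviation flux where
  "flux w x \<equiv> ip (indicator {0..x}) (lower_order w)"

lemma L2_flux: "w \<in> H10 \<Longrightarrow> L2 (flux w)"
  by (intro L2_continuous primitive_continuous L2_lower_order)

text \<open>Integration by parts puts the whole form on v'. It therefore vanishes for all v as soon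
  as w' - \<open>flux w\<close> is constant almost everywhere.\<close>

lemma Aform_eq_flux:
  assumes "w \<in> H10" "v \<in> H10"
  shows "Aform \<alpha> q p w v = ip (\<lambda>x. wderiv w x - flux w x) (wderiv v)"
  using assms
  by (simp add: Aform_eq ip_eq_neg_primitive L2_lower_order ip_diff_left L2_wderiv L2_flux)

text \<open>Let G be the flux, s its step approximation, v' = s - m and r = w - v. Then (r',r') =
  (w' - G, r') + (G - s, r') + (m, r'), where the first term is A(w,r) and the last is 0, so |r'| <=
  eps + b. Replacing s by G costs b once more, whence the factor 2. The bound on m keeps the
  functions G - m uniformly bounded.\<close>

lemma wderiv_near_flux:
  assumes part: "partition N xs" and w: "w \<in> Vh k N xs" and "0 \<le> \<epsilon>"
    and small: "\<And>v. v \<in> Vh k N xs \<Longrightarrow> \<bar>Aform \<alpha> q p w v\<bar> \<le> \<epsilon> * L2norm (wderiv v)"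
  obtains m where "\<bar>m\<bar> \<le> L2norm (lower_order w)"
    "L2norm (\<lambda>x. wderiv w x - (flux w x - m)) \<le> \<epsilon> + 2 * sqrt (mesh N xs) * L2norm (lower_order w)"
proof -
  define g where "g = lower_order w"
  define s where "s = piecewise N xs (\<lambda>i _. flux w (xs i))"
  define m where "m = ip (\<lambda>_. 1) s"
  define b where "b = sqrt (mesh N xs) * L2norm g"
  have H: "v \<in> H10" if "v \<in> Vh k N xs" for v
    using Vh_subset_H10[OF part] that by blast
  have g: "L2 g"
    unfolding g_def by (intro L2_lower_order H w)
  have s: "L2 s"
    unfolding s_def by (intro L2_piecewise continuous_intros)
  have s_G: "\<bar>s x - flux w x\<bar> \<le> b" "\<bar>s x\<bar> \<le> L2norm g" if "x \<in> {0..1}" for x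
    using step_approximation[OF part g that] by (simp_all add: s_def b_def g_def)
  have b: "0 \<le> b"
    by (simp add: b_def mesh_nonneg[OF part] L2norm_nonneg)
  have "\<bar>m\<bar> \<le> L2norm (\<lambda>_. 1) * L2norm s"
    unfolding m_def by (intro ip_Cauchy_Schwarz L2_const s)
  also have "\<dots> \<le> L2norm g"
    unfolding L2norm_one using L2norm_bound[OF L2_measurable[OF s] s_G(2) L2norm_nonneg] by simp
  finally have m_le: "\<bar>m\<bar> \<le> L2norm g" .
  obtain v where v: "v \<in> Vh k N xs" "AE x in unit_measure. wderiv v x = s x - m"
    unfolding m_def s_def by (rule step_primitive_in_Vh[OF part])
  define r where "r = (\<lambda>x. w x - v x)"
  have r: "r \<in> Vh k N xs"
    unfolding r_def by (rule Vh_diff[OF w v(1)])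
  have AE_r: "AE x in unit_measure. wderiv r x = wderiv w x - (s x - m)"
    using wderiv_diff[OF H[OF w] H[OF v(1)]] v(2) unfolding r_def by eventually_elim simp
  have Lw: "L2 (wderiv w)" and Lr: "L2 (wderiv r)" and LG: "L2 (flux w)"
    using w r by (auto intro: L2_wderiv L2_flux H)
  have Lsm: "L2 (\<lambda>x. s x - m)"
    by (intro L2_diff s L2_const)
  have LwG: "L2 (\<lambda>x. wderiv w x - flux w x)" and LGs: "L2 (\<lambda>x. flux w x - s x)"
    by (intro L2_diff Lw LG s)+
  have G_s: "L2norm (\<lambda>x. flux w x - s x) \<le> b"
    using s_G(1) b by (intro L2norm_bound L2_measurable LGs) (auto simp: abs_minus_commute)
  have "(L2norm (wderiv r))\<^sup>2 = ip (\<lambda>x. wderiv w x - (s x - m)) (wderiv r)"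
    unfolding L2norm_sq using AE_r by (intro ip_cong_AE L2_diff Lw Lsm Lr) auto
  also have "\<dots> = ip (\<lambda>x. (wderiv w x - flux w x) + ((flux w x - s x) + m)) (wderiv r)"
    by (intro ip_cong) auto
  also have "\<dots> = ip (\<lambda>x. wderiv w x - flux w x) (wderiv r) + (ip (\<lambda>x. flux w x - s x) (wderiv r) + ip (\<lambda>_. m) (wderiv r))"
    by (subst ip_add_left; (subst ip_add_left)?) (intro L2_add L2_const LwG LGs Lr refl)+
  also have "ip (\<lambda>_. m) (wderiv r) = 0"
    using ip_one_wderiv[OF H[OF r]] ip_one_const[of m] by simp
  also have "ip (\<lambda>x. wderiv w x - flux w x) (wderiv r) = Aform \<alpha> q p w r"
    by (rule Aform_eq_flux[symmetric]) (intro H w r)+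
  also have "Aform \<alpha> q p w r + (ip (\<lambda>x. flux w x - s x) (wderiv r) + 0) \<le>
      \<epsilon> * L2norm (wderiv r) + b * L2norm (wderiv r)"
    using small[OF r] ip_Cauchy_Schwarz[OF LGs Lr] mult_right_mono[OF G_s L2norm_nonneg[of "wderiv r"]]
    by linarith
  finally have "L2norm (wderiv r) * L2norm (wderiv r) \<le> (\<epsilon> + b) * L2norm (wderiv r)"
    by (simp add: power2_eq_square algebra_simps)
  then have r_le: "L2norm (wderiv r) \<le> \<epsilon> + b"
    using \<open>0 \<le> \<epsilon>\<close> b L2norm_nonneg[of "wderiv r"]
    by (cases "L2norm (wderiv r) = 0") (auto simp: mult_le_cancel_right)
  have "L2norm (\<lambda>x. wderiv w x - (flux w x - m)) \<le>
      L2norm (\<lambda>x. wderiv w x - (s x - m)) + L2norm (\<lambda>x. (s x - m) - (flux w x - m))"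
    by (intro L2norm_diff_triangle Lw Lsm L2_diff LG L2_const)
  also have "L2norm (\<lambda>x. wderiv w x - (s x - m)) = L2norm (wderiv r)"
    using AE_r by (intro L2norm_cong_AE L2_diff Lw Lsm Lr) auto
  also have "L2norm (\<lambda>x. (s x - m) - (flux w x - m)) = L2norm (\<lambda>x. flux w x - s x)"
    using L2norm_minus_commute[of s "flux w"] by simp
  finally have "L2norm (\<lambda>x. wderiv w x - (flux w x - m)) \<le> \<epsilon> + 2 * sqrt (mesh N xs) * L2norm g"
    using r_le G_s by (simp add: b_def)
  then show ?thesis
    using m_le that[of m] by (simp add: g_def)
qed

end

subsection \<open>Discrete stability\<close>

text \<open>Equality as functions and not as classes: the sup bound settles [0,1], the normalisation
  of \<open>H10\<close> the rest of the line.\<close>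

lemma H10_eq_0:
  assumes "w \<in> H10" "L2norm (wderiv w) = 0"
  shows "w = (\<lambda>x. 0)"
proof
  fix x
  show "w x = 0"
    using H10_bound[OF assms(1), of x] H10_zero_outside[OF assms(1), of x] assms(2)
    by (cases "x \<in> {0..1}") auto
qed

text \<open>By Poincare's inequality each of the two terms is at most the squared derivative
  norm.\<close>

lemma H1norm_le:
  assumes "w \<in> H10"
  shows "H1norm w \<le> sqrt 2 * L2norm (wderiv w)"
proof -
  have "ip w w \<le> ip (wderiv w) (wderiv w)"
    using L2norm_le_wderiv[OF assms] by (simp add: L2norm_def)
  then have "H1norm w \<le> sqrt (2 * ip (wderiv w) (wderiv w))"
    by (simp add: H1norm_def)
  then show ?thesis
    by (simp add: real_sqrt_mult L2norm_def)
qed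

context fractional_form
begin

text \<open>The inf-sup condition is phrased without a supremum: eps is any bound of A(w,.) relative
  to the derivative norm. The constants are uniform over all partitions of mesh at most
  \<open>h\<^sub>0\<close>.\<close>

lemma discrete_inf_sup:
  assumes nondeg: "\<And>w. w \<in> H10 \<Longrightarrow> (\<forall>v\<in>H10. Aform \<alpha> q p w v = 0) \<Longrightarrow> w = (\<lambda>x. 0)"
  obtains h\<^sub>0 \<delta> where "0 < h\<^sub>0" "0 < \<delta>"
    "\<And>N xs w \<epsilon>. partition N xs \<Longrightarrow> mesh N xs \<le> h\<^sub>0 \<Longrightarrow> w \<in> Vh k N xs \<Longrightarrow> 0 \<le> \<epsilon> \<Longrightarrow>
      (\<And>v. v \<in> Vh k N xs \<Longrightarrow> \<bar>Aform \<alpha> q p w v\<bar> \<le> \<epsilon> * L2norm (wderiv v)) \<Longrightarrow>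
      \<delta> * L2norm (wderiv w) \<le> \<epsilon>"
proof (rule ccontr)
  assume not: "\<not> thesis"
  \<comment> \<open>One null sequence bounds both the mesh and the residual: negating the claim with
    \<open>t n\<close> for both constants yields \<open>ex\<close>.\<close>
  define t where "t n = inverse (real (Suc n))" for n
  have t_pos: "t n > 0" for n
    by (simp add: t_def)
  have t_lim: "t \<longlonglongrightarrow> 0"
    unfolding t_def by (rule LIMSEQ_inverse_real_of_nat)
  define good where "good n w \<longleftrightarrow> (\<exists>N xs. partition N xs \<and> mesh N xs \<le> t n \<and> w \<in> Vh k N xs \<and>
      L2norm (wderiv w) = 1 \<and> (\<forall>v\<in>Vh k N xs. \<bar>Aform \<alpha> q p w v\<bar> \<le> t n * L2norm (wderiv v)))" for n w
  have ex: "\<exists>N xs w \<epsilon>. partition N xs \<and> mesh N xs \<le> t n \<and> w \<in> Vh k N xs \<and> 0 \<le> \<epsilon> \<and>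
      (\<forall>v\<in>Vh k N xs. \<bar>Aform \<alpha> q p w v\<bar> \<le> \<epsilon> * L2norm (wderiv v)) \<and> \<epsilon> < t n * L2norm (wderiv w)" for n
  proof (rule ccontr)
    assume none: "\<not> ?thesis"
    have thesis
      by (rule that[OF t_pos t_pos, of n n]) (use none in \<open>metis not_le\<close>)
    with not show False ..
  qed
  have "\<exists>w. good n w" for n
  proof -
    obtain N xs w \<epsilon> where *: "partition N xs" "mesh N xs \<le> t n" "w \<in> Vh k N xs" "0 \<le> \<epsilon>"
      "\<And>v. v \<in> Vh k N xs \<Longrightarrow> \<bar>Aform \<alpha> q p w v\<bar> \<le> \<epsilon> * L2norm (wderiv v)"
      "\<epsilon> < t n * L2norm (wderiv w)"
      using ex[of n] by metis
    \<comment> \<open>Normalisation is possible because 0 <= eps < t_n |w'| forces |w'| > 0.\<close>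
    define c where "c = inverse (L2norm (wderiv w))"
    have pos: "0 < L2norm (wderiv w)"
      using *(4,6) t_pos[of n] by (metis L2norm_nonneg le_less_trans mult_zero_right not_less order_le_less)
    have c: "0 < c" "c * L2norm (wderiv w) = 1"
      using pos by (simp_all add: c_def)
    have H: "v \<in> H10" if "v \<in> Vh k N xs" for v
      using Vh_subset_H10[OF *(1)] that by blast
    have "L2norm (wderiv (\<lambda>x. c * w x)) = L2norm (\<lambda>x. c * wderiv w x)"
      by (intro L2norm_cong_AE wderiv_cmult L2_wderiv L2_cmult H10_cmult H *(3))
    also have "\<dots> = 1"
      using c by (simp add: L2norm_cmult)
    finally have "L2norm (wderiv (\<lambda>x. c * w x)) = 1" .
    moreover have "\<bar>Aform \<alpha> q p (\<lambda>x. c * w x) v\<bar> \<le> t n * L2norm (wderiv v)" if v: "v \<in> Vh k N xs" for v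
    proof -
      have "\<bar>Aform \<alpha> q p (\<lambda>x. c * w x) v\<bar> = c * \<bar>Aform \<alpha> q p w v\<bar>"
        using c by (simp add: Aform_cmult_left H *(3) v abs_mult)
      also have "\<dots> \<le> c * (\<epsilon> * L2norm (wderiv v))"
        using c *(5)[OF v] by (intro mult_left_mono) auto
      also have "\<dots> = (c * \<epsilon>) * L2norm (wderiv v)"
        by simp
      also have "\<dots> \<le> t n * L2norm (wderiv v)"
        using mult_left_mono[OF less_imp_le[OF *(6)], of c] c
        by (intro mult_right_mono L2norm_nonneg) (simp add: mult.left_commute[of c])
      finally show ?thesis .
    qed
    ultimately have "good n (\<lambda>x. c * w x)"
      unfolding good_def using *(1,2) Vh_cmult[OF *(3)] by blast
    then show ?thesis
      by (rule exI[of _ "\<lambda>x. c * w x"])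
  qed
  then obtain w where good: "\<And>n. good n (w n)"
    by metis
  have wH: "w n \<in> H10" and w1: "L2norm (wderiv (w n)) = 1" for n
    using good[of n] Vh_subset_H10 by (auto simp: good_def)
  obtain K where K: "K > 0" "\<And>w. w \<in> H10 \<Longrightarrow> L2norm (lower_order w) \<le> K * L2norm (wderiv w)"
    by (rule lower_order_bounded) blast
  have lower_K: "L2norm (lower_order (w n)) \<le> K" for n
    using K(2)[OF wH[of n]] by (simp add: w1)
  have "\<exists>m. \<bar>m\<bar> \<le> K \<and>
      L2norm (\<lambda>x. wderiv (w n) x - (flux (w n) x - m)) \<le> t n + 2 * sqrt (t n) * K" for n
  proof -
    obtain N xs where *: "partition N xs" "mesh N xs \<le> t n" "w n \<in> Vh k N xs"
      "\<And>v. v \<in> Vh k N xs \<Longrightarrow> \<bar>Aform \<alpha> q p (w n) v\<bar> \<le> t n * L2norm (wderiv v)"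
      using good[of n] unfolding good_def by blast
    obtain m where m: "\<bar>m\<bar> \<le> L2norm (lower_order (w n))"
      "L2norm (\<lambda>x. wderiv (w n) x - (flux (w n) x - m)) \<le> t n + 2 * sqrt (mesh N xs) * L2norm (lower_order (w n))"
      using wderiv_near_flux[OF *(1,3) less_imp_le[OF t_pos] *(4)] by blast
    have "2 * sqrt (mesh N xs) * L2norm (lower_order (w n)) \<le> 2 * sqrt (t n) * K"
      using *(2) lower_K[of n] mesh_nonneg[OF *(1)] t_pos[of n] by (intro mult_mono) (auto simp: L2norm_nonneg)
    then show ?thesis
      using m lower_K[of n] by (intro exI[of _ m]) linarith
  qed
  then obtain m where m: "\<And>n. \<bar>m n\<bar> \<le> K"
    "\<And>n. L2norm (\<lambda>x. wderiv (w n) x - (flux (w n) x - m n)) \<le> t n + 2 * sqrt (t n) * K"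
    by metis
  define F where "F n x = flux (w n) x - m n" for n x
  have F_bound: "norm (F n x) \<le> 2 * K" if "x \<in> {0..1}" for n x
    using primitive_bound[OF L2_lower_order[OF wH[of n]] that] lower_K[of n] m(1)[of n]
    unfolding F_def real_norm_def by linarith
  have F_Hoelder: "\<bar>F n x - F n y\<bar> \<le> sqrt \<bar>x - y\<bar> * K" if "x \<in> {0..1}" "y \<in> {0..1}" for n x y
    using primitive_Hoelder[OF L2_lower_order[OF wH[of n]] that]
      mult_left_mono[OF lower_K[of n], of "sqrt \<bar>x - y\<bar>"] by (simp add: F_def)
  have F_equi: "\<exists>d>0. \<forall>n y. y \<in> {0..1} \<and> norm (x - y) < d \<longrightarrow> norm (F n x - F n y) < e"
    if x: "x \<in> {0..1}" and e: "0 < e" for x e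
  proof (intro exI conjI allI impI)
    \<comment> \<open>Inverts the modulus of continuity d -> K sqrt(d), which is the same for all
      n.\<close>
    show "0 < (e / K)\<^sup>2"
      using e K(1) by simp
    fix n y assume y: "y \<in> {0..1} \<and> norm (x - y) < (e / K)\<^sup>2"
    have "sqrt \<bar>x - y\<bar> < e / K"
      using y e K(1) by (intro real_less_lsqrt) auto
    then have "sqrt \<bar>x - y\<bar> * K < e"
      using K(1) by (simp add: field_simps)
    then show "norm (F n x - F n y) < e"
      using F_Hoelder[OF x, of y n] y by simp
  qed
  obtain z r where z: "continuous_on {0..1} z" "strict_mono (r :: nat \<Rightarrow> nat)"
    "\<And>e. 0 < e \<Longrightarrow> \<exists>M. \<forall>n x. n \<ge> M \<and> x \<in> {0..1} \<longrightarrow> norm (F (r n) x - z x) < e"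
    using Arzela_Ascoli[of "{0..1::real}" F "2 * K", OF compact_Icc F_bound F_equi] by blast
  have Lz: "L2 z"
    by (rule L2_continuous[OF z(1)])
  have LF: "L2 (F n)" for n
    unfolding F_def by (intro L2_diff L2_flux wH L2_const)
  have Lw: "L2 (wderiv (w n))" for n
    by (intro L2_wderiv wH)
  have F_lim: "(\<lambda>n. F (r n) x) \<longlonglongrightarrow> z x" if "x \<in> {0..1}" for x
    using z(3) that by (intro LIMSEQ_I) meson
  have F_L2_lim: "(\<lambda>n. L2norm (\<lambda>x. F (r n) x - z x)) \<longlonglongrightarrow> 0"
  proof (rule LIMSEQ_I)
    fix e :: real assume e: "0 < e"
    obtain M where M: "\<And>n x. n \<ge> M \<Longrightarrow> x \<in> {0..1} \<Longrightarrow> norm (F (r n) x - z x) < e / 2"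
      using z(3)[of "e / 2"] e by auto
    have "L2norm (\<lambda>x. F (r n) x - z x) \<le> e / 2" if "n \<ge> M" for n
      using M[OF that] e by (intro L2norm_bound L2_measurable L2_diff LF Lz) (auto intro: less_imp_le)
    then show "\<exists>M. \<forall>n\<ge>M. norm (L2norm (\<lambda>x. F (r n) x - z x) - 0) < e"
      using e by (intro exI[of _ M]) (fastforce simp: L2norm_nonneg)
  qed
  define d where "d n = L2norm (\<lambda>x. wderiv (w (r n)) x - z x)" for n
  have d_lim: "d \<longlonglongrightarrow> 0"
  proof (rule Lim_null_comparison)
    show "\<forall>\<^sub>F n in sequentially. norm (d n) \<le>
        (t (r n) + 2 * sqrt (t (r n)) * K) + L2norm (\<lambda>x. F (r n) x - z x)"
    proof (intro always_eventually allI)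
      fix n
      show "norm (d n) \<le> (t (r n) + 2 * sqrt (t (r n)) * K) + L2norm (\<lambda>x. F (r n) x - z x)"
        using L2norm_diff_triangle[OF Lw LF Lz, of "r n" "r n"] m(2)[of "r n"]
        by (simp add: d_def F_def L2norm_nonneg)
    qed
    have "(\<lambda>n. t (r n)) \<longlonglongrightarrow> 0"
      using LIMSEQ_subseq_LIMSEQ[OF t_lim z(2)] by (simp add: o_def)
    then have "(\<lambda>n. (t (r n) + 2 * sqrt (t (r n)) * K) + L2norm (\<lambda>x. F (r n) x - z x)) \<longlonglongrightarrow> (0 + 2 * sqrt 0 * K) + 0"
      by (intro tendsto_intros F_L2_lim)
    then show "(\<lambda>n. (t (r n) + 2 * sqrt (t (r n)) * K) + L2norm (\<lambda>x. F (r n) x - z x)) \<longlonglongrightarrow> 0"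
      by simp
  qed
  \<comment> \<open>The limit is not extracted from the \<open>w n\<close> but built as the
    primitive of z, the limit of their derivatives.\<close>
  define W where "W x = (if x \<in> {0..1} then ip (indicator {0..x}) z else 0)" for x
  have W_eq: "W x = ip (indicator {0..x}) z" if "x \<in> {0..1}" for x
    using that by (simp add: W_def)
  \<comment> \<open>Each derivative has mean zero, so Cauchy-Schwarz bounds the mean of z by its
    distance \<open>d n\<close> to that derivative. Hence W(1) = 0.\<close>
  have "\<bar>ip (\<lambda>_. 1) z\<bar> \<le> d n" for n
  proof -
    have "ip (\<lambda>_. 1) (\<lambda>x. wderiv (w (r n)) x - z x) = - ip (\<lambda>_. 1) z"
      by (simp add: ip_diff_right L2_const Lw Lz ip_one_wderiv wH)
    then show ?thesis
      using ip_Cauchy_Schwarz[OF L2_const L2_diff[OF Lw Lz], of 1 "r n"] by (simp add: d_def L2norm_one)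
  qed
  then have mean_z: "ip (\<lambda>_. 1) z = 0"
    using LIMSEQ_le_const[OF d_lim, of "\<bar>ip (\<lambda>_. 1) z\<bar>"] by simp
  have WH: "W \<in> H10"
    by (rule H10I[OF Lz W_eq]) (auto simp: W_def ip_indicator_Icc_1 mean_z)
  have W': "AE x in unit_measure. wderiv W x = z x"
    by (rule wderiv_AE_eq[OF WH Lz W_eq])
  \<comment> \<open>The flux is linear in w and bounded by the derivative norm, so L2 convergence of
    the derivatives gives convergence at every point.\<close>
  have flux_lim: "(\<lambda>n. flux (w (r n)) x) \<longlonglongrightarrow> flux W x" if x: "x \<in> {0..1}" for x
  proof -
    have "\<bar>flux (w (r n)) x - flux W x\<bar> \<le> K * d n" for n
    proof -
      let ?u = "\<lambda>x. w (r n) x - W x"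
      have uH: "?u \<in> H10"
        by (rule H10_diff[OF wH WH])
      have "flux (w (r n)) x = flux (\<lambda>x. ?u x + W x) x"
        by simp
      also have "\<dots> = ip (indicator {0..x}) (\<lambda>x. lower_order ?u x + lower_order W x)"
        using lower_order_add[OF uH WH] by (intro ip_cong) auto
      also have "\<dots> = flux ?u x + flux W x"
        by (intro ip_add_right L2_indicator_Icc L2_lower_order uH WH)
      finally have "\<bar>flux (w (r n)) x - flux W x\<bar> \<le> L2norm (lower_order ?u)"
        using primitive_bound[OF L2_lower_order[OF uH] x] by simp
      also have "\<dots> \<le> K * L2norm (wderiv ?u)"
        by (rule K(2)[OF uH])
      also have "L2norm (wderiv ?u) = d n"
        unfolding d_def
      proof (rule L2norm_cong_AE)
        show "AE x in unit_measure. wderiv ?u x = wderiv (w (r n)) x - z x"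
          using wderiv_diff[OF wH WH, of "r n"] W' by eventually_elim simp
      qed (intro L2_wderiv uH L2_diff Lw Lz)+
      finally show ?thesis .
    qed
    then have "\<forall>\<^sub>F n in sequentially. norm (flux (w (r n)) x - flux W x) \<le> K * d n"
      by simp
    moreover have "(\<lambda>n. K * d n) \<longlonglongrightarrow> 0"
      using tendsto_mult_left[OF d_lim, of K] by simp
    ultimately have "(\<lambda>n. flux (w (r n)) x - flux W x) \<longlonglongrightarrow> 0"
      by (rule Lim_null_comparison)
    then show ?thesis
      by (simp add: LIM_zero_iff)
  qed
  \<comment> \<open>The shifts \<open>m (r n)\<close> do not involve x, so their limit, expressed
    here at each x, is one constant.\<close>
  have m_lim: "(\<lambda>n. m (r n)) \<longlonglongrightarrow> flux W x - z x" if "x \<in> {0..1}" for x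
    using tendsto_diff[OF flux_lim[OF that] F_lim[OF that]] by (simp add: F_def)
  define c where "c = flux W 0 - z 0"
  have z_eq: "z x = flux W x - c" if "x \<in> {0..1}" for x
    using LIMSEQ_unique[OF m_lim[OF that] m_lim[of 0]] by (simp add: c_def)
  have "Aform \<alpha> q p W v = 0" if v: "v \<in> H10" for v
  proof -
    have "Aform \<alpha> q p W v = ip (\<lambda>x. wderiv W x - flux W x) (wderiv v)"
      by (rule Aform_eq_flux[OF WH v])
    also have "\<dots> = ip (\<lambda>x. - c) (wderiv v)"
    proof (rule ip_cong_AE)
      have "AE x in unit_measure. x \<in> {0..1}"
        by (rule AE_I2) simp
      then show "AE x in unit_measure. wderiv W x - flux W x = - c"
        using W' by eventually_elim (simp add: z_eq)
    qed (auto intro!: L2_diff L2_wderiv L2_flux L2_const WH v)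
    also have "\<dots> = 0"
      using ip_one_const[of "- c"] ip_one_wderiv[OF v] by simp
    finally show ?thesis .
  qed
  then have "W = (\<lambda>x. 0)"
    using nondeg[OF WH] by blast
  then have "AE x in unit_measure. z x = 0"
    using W_eq by (intro AE_0_of_primitive_0[OF Lz]) metis
  then have "L2norm (\<lambda>x. 0) = L2norm z"
    by (intro L2norm_cong_AE L2_const Lz) auto
  then have "L2norm z = 0"
    by (simp add: L2norm_def ip_def)
  \<comment> \<open>With z = 0, the whole unit norm of the derivative is its distance to z, which
    tends to 0.\<close>
  then have "1 \<le> d n" for n
    using L2norm_triangle[OF L2_diff[OF Lw Lz] Lz, of "r n"] by (simp add: d_def w1)
  then show False
    using LIMSEQ_le_const[OF d_lim, of 1] by auto
qed

end

theorem theorem4p2: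
  fixes \<alpha> :: real and q p :: "real \<Rightarrow> real" and k :: nat and \<sigma> :: real
  assumes "3/2 < \<alpha>" and "\<alpha> < 2"
    and "Linf q" and "L2 p"
    and "\<And>w. w \<in> H10 \<Longrightarrow> (\<forall>v\<in>H10. Aform \<alpha> q p w v = 0) \<Longrightarrow> w = (\<lambda>x. 0)"
    and "\<And>v. v \<in> H10 \<Longrightarrow> (\<forall>w\<in>H10. Aform \<alpha> q p w v = 0) \<Longrightarrow> v = (\<lambda>x. 0)"
    and "k \<in> {0, 1}" and "\<sigma> > 0"
  shows "\<exists>h0 > 0. \<exists>c. \<forall>N xs. partition N xs \<and> quasi_uniform \<sigma> N xs \<and> mesh N xs \<le> h0 \<longrightarrow>
           (\<forall>f. L2 f \<longrightarrow>
              (\<exists>!wh. wh \<in> Vh k N xs \<and> (\<forall>vh\<in>Vh k N xs. Aform \<alpha> q p wh vh = ip f vh))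
            \<and> (\<forall>wh. wh \<in> Vh k N xs \<and> (\<forall>vh\<in>Vh k N xs. Aform \<alpha> q p wh vh = ip f vh)
                  \<longrightarrow> H1norm wh \<le> c * L2norm f))"
proof -
  interpret fractional_form \<alpha> q p
    by unfold_locales (use assms in auto)
  obtain h\<^sub>0 \<delta> where pos: "0 < h\<^sub>0" "0 < \<delta>"
    and inf_sup: "\<And>N xs w \<epsilon>. partition N xs \<Longrightarrow> mesh N xs \<le> h\<^sub>0 \<Longrightarrow> w \<in> Vh k N xs \<Longrightarrow> 0 \<le> \<epsilon> \<Longrightarrow>
      (\<And>v. v \<in> Vh k N xs \<Longrightarrow> \<bar>Aform \<alpha> q p w v\<bar> \<le> \<epsilon> * L2norm (wderiv v)) \<Longrightarrow>
      \<delta> * L2norm (wderiv w) \<le> \<epsilon>"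
    using discrete_inf_sup[OF assms(5)] by metis
  \<comment> \<open>The factor 1/delta comes from the inf-sup condition and sqrt 2 from the full H1
    norm; both are independent of the partition and of f.\<close>
  have main: "(\<exists>!w. w \<in> Vh k N xs \<and> (\<forall>v\<in>Vh k N xs. Aform \<alpha> q p w v = ip f v)) \<and>
      (\<forall>w. w \<in> Vh k N xs \<and> (\<forall>v\<in>Vh k N xs. Aform \<alpha> q p w v = ip f v) \<longrightarrow> H1norm w \<le> sqrt 2 / \<delta> * L2norm f)"
    if part: "partition N xs" and mesh: "mesh N xs \<le> h\<^sub>0" and f: "L2 f" for N xs f
  proof -
    have H: "v \<in> H10" if "v \<in> Vh k N xs" for v
      using Vh_subset_H10[OF part] that by blast
    have inj: "w = (\<lambda>x. 0)" if w: "w \<in> Vh k N xs" "\<forall>v\<in>Vh k N xs. Aform \<alpha> q p w v = 0" for w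
    proof -
      have "\<delta> * L2norm (wderiv w) \<le> 0"
        using inf_sup[OF part mesh w(1), of 0] w(2) by simp
      then have "L2norm (wderiv w) = 0"
        using pos L2norm_nonneg[of "wderiv w"] by (simp add: mult_le_0_iff)
      then show ?thesis
        by (rule H10_eq_0[OF H[OF w(1)]])
    qed
    obtain B where B: "finite B" "Vh k N xs \<subseteq> fun_vs.span B"
      by (rule Vh_finite_span[OF part])
    have zero: "(\<lambda>x. 0) \<in> Vh k N xs"
      by (auto simp: Vh_def intro!: exI[of _ 0])
    have ex: "\<exists>w\<in>Vh k N xs. \<forall>v\<in>Vh k N xs. Aform \<alpha> q p w v = ip f v"
      using B by (intro finite_dim_solvable[where B = B])
        (simp_all add: zero Vh_add Vh_cmult Aform_add_left Aform_cmult_left Aform_add_right Aform_cmult_right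
          ip_add_right ip_cmult_right f H H10_L2 inj)
    have unique: "w = w'" if w: "w \<in> Vh k N xs" "\<forall>v\<in>Vh k N xs. Aform \<alpha> q p w v = ip f v"
      and w': "w' \<in> Vh k N xs" "\<forall>v\<in>Vh k N xs. Aform \<alpha> q p w' v = ip f v" for w w'
    proof -
      let ?u = "\<lambda>x. w x - w' x"
      have u: "?u \<in> Vh k N xs"
        by (rule Vh_diff[OF w(1) w'(1)])
      \<comment> \<open>Additivity is applied to w = (w - w') + w'.\<close>
      have "Aform \<alpha> q p ?u v = 0" if v: "v \<in> Vh k N xs" for v
        using Aform_add_left[OF H[OF u] H[OF w'(1)] H[OF v]] w(2) w'(2) v by simp
      then have "?u = (\<lambda>x. 0)"
        using inj[OF u] by blast
      then show ?thesis
        by (simp add: fun_eq_iff)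
    qed
    have "H1norm w \<le> sqrt 2 / \<delta> * L2norm f"
      if w: "w \<in> Vh k N xs" "\<forall>v\<in>Vh k N xs. Aform \<alpha> q p w v = ip f v" for w
    proof -
      \<comment> \<open>The residual bound eps = |f| results from Cauchy-Schwarz followed by
        Poincare's inequality for v.\<close>
      have "\<bar>Aform \<alpha> q p w v\<bar> \<le> L2norm f * L2norm (wderiv v)" if v: "v \<in> Vh k N xs" for v
        using ip_Cauchy_Schwarz[OF f H10_L2[OF H[OF v]]] w(2) v
          mult_left_mono[OF L2norm_le_wderiv[OF H[OF v]] L2norm_nonneg[of f]] by auto
      then have "\<delta> * L2norm (wderiv w) \<le> L2norm f"
        by (rule inf_sup[OF part mesh w(1) L2norm_nonneg])
      then have "L2norm (wderiv w) \<le> L2norm f / \<delta>"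
        using pos by (simp add: field_simps)
      then have "sqrt 2 * L2norm (wderiv w) \<le> sqrt 2 * (L2norm f / \<delta>)"
        by (rule mult_left_mono) simp
      then show ?thesis
        using H1norm_le[OF H[OF w(1)]] by simp
    qed
    then show ?thesis
      using ex unique by blast
  qed
  show ?thesis
    using pos main by blast
qed

end
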